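(* Let $\mathbb{F}$ be a field of characteristic zero and $\chi:S_n\to\mathbb{C}^\times$ a character. Let $C$ be any arithmetic circuit and let $f_1,\ldots,f_m\in\mathbb{F}[x_{ij}:1\le i,j\le n]$ be polynomials (of any degree), each with at most $s$ monomials, such that $\mathrm{trdeg}_{\mathbb{F}}\{f_1,\ldots,f_m\}\le r$. If $C(f_1,\ldots,f_m)=\mathrm{Imm}_\chi(M)$ where $M=(x_{ij})_{n\times n}$, then $s=2^{\Omega(n/r)}$.
   Context: $\mathrm{Imm}_\chi(M)=\sum_{\sigma\in S_n}\chi(\sigma)\prod_{i=1}^n x_{i\sigma(i)}$. $\mathrm{trdeg}_{\mathbb{F}}$ of a finite set of polynomials is the size of a maximal subset that is algebraically independent over $\mathbb{F}$ (no nonzero polynomial relation with coefficients in $\mathbb{F}$). *)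

theory Defs
  imports
    Complex_Main
    "HOL-Combinatorics.Permutations"
    "HOL-Library.Poly_Mapping"
    "Jordan_Normal_Form.Matrix"
begin

section \<open>Multivariate polynomials\<close>

text \<open>
  A polynomial over \<open>'a\<close> in variables of type \<open>'v\<close> is a finitely supported map from
  monomials (finitely supported exponent maps) to coefficients; the ring structure is that of
  \<open>Poly_Mapping\<close>.  The monomials that occur in \<open>p\<close> are \<open>Poly_Mapping.keys p\<close>.
\<close>

type_synonym ('v, 'a) mpoly = "('v \<Rightarrow>\<^sub>0 nat) \<Rightarrow>\<^sub>0 'a"

definition mconst :: "'a::zero \<Rightarrow> ('v, 'a) mpoly" where
  "mconst a = Poly_Mapping.single 0 a"

definition indets :: "('v, 'a::zero) mpoly \<Rightarrow> 'v set" where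
  "indets p = (\<Union>m\<in>Poly_Mapping.keys p. Poly_Mapping.keys m)"

definition num_monomials :: "('v, 'a::zero) mpoly \<Rightarrow> nat" where
  "num_monomials p = card (Poly_Mapping.keys p)"

definition subst :: "('w \<Rightarrow> ('v, 'a::comm_ring_1) mpoly) \<Rightarrow> ('w, 'a) mpoly \<Rightarrow> ('v, 'a) mpoly" where
  "subst g p = (\<Sum>m\<in>Poly_Mapping.keys p.
     mconst (Poly_Mapping.lookup p m) *
     (\<Prod>w\<in>Poly_Mapping.keys m. g w ^ Poly_Mapping.lookup m w))"


section \<open>Algebraic independence and transcendence degree\<close>

text \<open>The elements of \<open>A\<close> serve as the names of the variables of a polynomial relation on \<open>A\<close>.\<close>

definition alg_independent :: "('v, 'a::comm_ring_1) mpoly set \<Rightarrow> bool" where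
  "alg_independent A \<longleftrightarrow>
     (\<forall>R :: (('v, 'a) mpoly, 'a) mpoly. indets R \<subseteq> A \<and> subst (\<lambda>g. g) R = 0 \<longrightarrow> R = 0)"

text \<open>Meant for finite \<open>A\<close> only.\<close>

definition trdeg :: "('v, 'a::comm_ring_1) mpoly set \<Rightarrow> nat" where
  "trdeg A = Max {card B | B. B \<subseteq> A \<and> alg_independent B}"


section \<open>Arithmetic circuits\<close>

text \<open>
  A circuit is a list of gates in topological order, the last one being the output gate.
  \<open>Input i\<close> reads the \<open>i\<close>-th input (counted from 1); \<open>Plus\<close> and \<open>Times\<close> have unbounded fan-in
  and refer to earlier gates by their positions in the list (counted from 0).
\<close>

datatype 'a gate = Input nat | Const 'a | Plus "nat list" | Times "nat list"

type_synonym 'a circuit = "'a gate list"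

fun gate_ok :: "nat \<Rightarrow> nat \<Rightarrow> 'a gate \<Rightarrow> bool" where
  "gate_ok m k (Input i) \<longleftrightarrow> i \<in> {1..m}"
| "gate_ok m k (Const a) \<longleftrightarrow> True"
| "gate_ok m k (Plus js) \<longleftrightarrow> set js \<subseteq> {..<k}"
| "gate_ok m k (Times js) \<longleftrightarrow> set js \<subseteq> {..<k}"

definition is_circuit :: "nat \<Rightarrow> 'a circuit \<Rightarrow> bool" where
  "is_circuit m C \<longleftrightarrow> C \<noteq> [] \<and> (\<forall>k<length C. gate_ok m k (C ! k))"

fun gate_value ::
  "(nat \<Rightarrow> ('v, 'a::comm_ring_1) mpoly) \<Rightarrow> ('v, 'a) mpoly list \<Rightarrow> 'a gate \<Rightarrow> ('v, 'a) mpoly" where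
  "gate_value f vs (Input i) = f i"
| "gate_value f vs (Const a) = mconst a"
| "gate_value f vs (Plus js) = (\<Sum>j\<leftarrow>js. vs ! j)"
| "gate_value f vs (Times js) = (\<Prod>j\<leftarrow>js. vs ! j)"

definition gate_values ::
  "'a circuit \<Rightarrow> (nat \<Rightarrow> ('v, 'a::comm_ring_1) mpoly) \<Rightarrow> ('v, 'a) mpoly list" where
  "gate_values C f = foldl (\<lambda>vs g. vs @ [gate_value f vs g]) [] C"

definition circuit_output ::
  "'a circuit \<Rightarrow> (nat \<Rightarrow> ('v, 'a::comm_ring_1) mpoly) \<Rightarrow> ('v, 'a) mpoly" where
  "circuit_output C f = last (gate_values C f)"


section \<open>Characters of the symmetric group and immanants\<close>

definition Sym :: "nat \<Rightarrow> (nat \<Rightarrow> nat) set" where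
  "Sym n = {\<sigma>. \<sigma> permutes {1..n}}"

definition is_representation :: "nat \<Rightarrow> nat \<Rightarrow> ((nat \<Rightarrow> nat) \<Rightarrow> complex mat) \<Rightarrow> bool" where
  "is_representation n d \<rho> \<longleftrightarrow>
     (\<forall>\<sigma>\<in>Sym n. \<rho> \<sigma> \<in> carrier_mat d d) \<and> \<rho> id = 1\<^sub>m d \<and>
     (\<forall>\<sigma>\<in>Sym n. \<forall>\<tau>\<in>Sym n. \<rho> (\<sigma> \<circ> \<tau>) = \<rho> \<sigma> * \<rho> \<tau>)"

text \<open>
  A character with values in the nonzero complex numbers: the trace of a complex representation,
  required to vanish nowhere.  For \<open>d = 1\<close> these are exactly the group homomorphisms into the
  multiplicative group of the complex numbers.
\<close>

definition is_nonzero_character :: "nat \<Rightarrow> ((nat \<Rightarrow> nat) \<Rightarrow> complex) \<Rightarrow> bool" where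
  "is_nonzero_character n \<chi> \<longleftrightarrow>
     (\<exists>d \<rho>. is_representation n d \<rho> \<and> (\<forall>\<sigma>\<in>Sym n. \<chi> \<sigma> = (\<Sum>i<d. \<rho> \<sigma> $$ (i, i)))) \<and>
     (\<forall>\<sigma>\<in>Sym n. \<chi> \<sigma> \<noteq> 0)"

text \<open>
  All character values of a symmetric group are rational (indeed integers).  This is what gives
  \<open>\<chi> \<sigma>\<close> a meaning in an arbitrary field of characteristic zero: complex rationals are transported
  along the common prime field.  On irrational complex numbers the function is unspecified.
\<close>

definition rat_scalar :: "complex \<Rightarrow> 'a::field_char_0" where
  "rat_scalar z = of_rat (THE q. of_rat q = z)"

definition immanant :: "nat \<Rightarrow> ((nat \<Rightarrow> nat) \<Rightarrow> complex) \<Rightarrow> (nat \<times> nat, 'a::field_char_0) mpoly" where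
  "immanant n \<chi> = (\<Sum>\<sigma>\<in>Sym n. mconst (rat_scalar (\<chi> \<sigma>)) *
     (\<Prod>i=1..n. Poly_Mapping.single (Poly_Mapping.single (i, \<sigma> i) 1) 1))"

lemma rat_scalar_of_rat [simp]: "rat_scalar (of_rat q) = of_rat q"
  by (simp add: rat_scalar_def)

end

theory Submission
  imports
    Defs
    "HOL-Combinatorics.Cycles"
    "HOL-Number_Theory.Cong"
    "HOL-Library.Product_Lexorder"
    "Jordan_Normal_Form.Schur_Decomposition"
begin

text \<open>
  The operators \<open>x \<partial>/\<partial>x\<close> only rescale coefficients.  Therefore a \<open>k \<times> k\<close> minor of the Jacobian of
  \<open>f\<^sub>1, \<dots>, f\<^sub>m\<close> formed with them is supported on sums of \<open>k\<close> exponents of the \<open>f\<^sub>i\<close>: at most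
  \<open>s ^ k\<close> of them, for all choices of the variables simultaneously and without the factor \<open>k!\<close> of
  the Leibniz formula.  In characteristic zero minors with more than \<open>trdeg\<close> rows vanish.  For a
  nonzero minor of maximal size \<open>k \<le> r\<close>, expanding a bordered minor gives a derivation
  that kills every \<open>f\<^sub>i\<close>, hence every polynomial in them and in particular the immanant.

  Inside the \<open>2 \<times> 2\<close> diagonal blocks there are \<open>n / 2\<close> independent binary choices of permutations.
  A halving argument finds an exponent \<open>\<mu>\<close> of the minors such that, after at most \<open>k log s\<close> of
  these choices are fixed, the product of \<open>\<mu>\<close> with any such permutation monomial factors uniquely.
  If another block is both free and disjoint from the variables of the minor, bordering with
  a variable of that block and comparing two coefficients shows that \<open>\<mu>\<close> does not occur in the
  minor.  Hence \<open>n / 2 \<le> k log s + k\<close>.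

  The coefficients of the immanant are nonzero because characters of the symmetric group are
  rational: \<open>\<sigma>\<close> is conjugate to \<open>\<sigma> ^ k\<close> for \<open>k\<close> prime to its order, so the trace of \<open>\<sigma>\<close> is an average
  of Ramanujan sums.
\<close>

section \<open>Rationality of the characters of the symmetric group\<close>

text \<open>This is a Ramanujan sum. Sorting \<open>1..N\<close> by the gcd with \<open>N\<close>
  splits a geometric sum, equal to \<open>N\<close> or \<open>0\<close>, into the coprime sum and
  the coprime sums of the powers \<open>z ^ g\<close> at smaller moduli, so induction on
  \<open>N\<close> applies.\<close>

lemma sum_coprime_powers_root_of_unity_Rats:
  fixes z :: complex
  assumes "N > 0" "z ^ N = 1"
  shows "(\<Sum>k | k \<in> {1..N} \<and> coprime k N. z ^ k) \<in> \<rat>"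
  using assms
proof (induction N arbitrary: z rule: less_induct)
  case (less N)
  define S where "S = (\<lambda>g. \<Sum>k | k \<in> {1..N} \<and> gcd k N = g. z ^ k)"
  have "(\<Sum>k=1..N. z ^ k) = z * (\<Sum>k<N. z ^ k)"
    unfolding sum_distrib_left
    by (rule sum.reindex_bij_witness[where i = Suc and j = "\<lambda>k. k - 1"])
      (auto simp flip: power_Suc)
  also have "\<dots> \<in> \<rat>"
    using less.prems geometric_sum[of z N] by (cases "z = 1") auto
  finally have total: "(\<Sum>k=1..N. z ^ k) \<in> \<rat>" .
  have fin: "finite {g. g dvd N}"
    using less.prems by simp
  have "(\<Sum>k=1..N. z ^ k) = (\<Sum>g | g dvd N. S g)"
    unfolding S_def by (rule sum.group[OF _ fin, symmetric]) auto
  also have "\<dots> = S 1 + (\<Sum>g\<in>{g. g dvd N} - {1}. S g)"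
    by (rule sum.remove) (use fin in auto)
  finally have split: "S 1 = (\<Sum>k=1..N. z ^ k) - (\<Sum>g\<in>{g. g dvd N} - {1}. S g)"
    by simp
  have "S g \<in> \<rat>" if g: "g dvd N" "g \<noteq> 1" for g
  proof -
    obtain M where M: "N = g * M"
      using g by blast
    have pos: "g > 0" "M > 0" "M < N"
      using M g less.prems by (auto intro: Nat.gr0I)
    have "S g = (\<Sum>k | k \<in> {1..M} \<and> coprime k M. (z ^ g) ^ k)"
      unfolding S_def
    proof (rule sum.reindex_bij_witness[where i = "\<lambda>k. g * k" and j = "\<lambda>k. k div g"])
      fix k
      assume k: "k \<in> {k. k \<in> {1..N} \<and> gcd k N = g}"
      then have "g dvd k"
        by auto
      then obtain l where l: "k = g * l"
        by blast
      have "g * gcd l M = g"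
        using k M l by (simp add: gcd_mult_distrib_nat)
      then show "g * (k div g) = k" "k div g \<in> {k. k \<in> {1..M} \<and> coprime k M}"
        "(z ^ g) ^ (k div g) = z ^ k"
        using k M l pos by (auto simp: coprime_iff_gcd_eq_1 simp flip: power_mult intro: Nat.gr0I)
    next
      fix k
      assume "k \<in> {k. k \<in> {1..M} \<and> coprime k M}"
      then show "g * k div g = k" "g * k \<in> {k. k \<in> {1..N} \<and> gcd k N = g}"
        using pos M by (auto simp: coprime_iff_gcd_eq_1 simp flip: gcd_mult_distrib_nat intro: Nat.gr0I)
    qed
    also have "\<dots> \<in> \<rat>"
      by (rule less.IH) (use pos less.prems M in \<open>auto simp flip: power_mult\<close>)
    finally show ?thesis .
  qed
  then have "S 1 \<in> \<rat>"
    unfolding split by (intro Rats_diff[OF total] Rats_sum) auto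
  then show ?case
    by (simp add: S_def coprime_iff_gcd_eq_1)
qed

section \<open>Traces of powers of a matrix of finite order\<close>

lemma upper_triangular_pow:
  fixes A :: "'a::semiring_1 mat"
  assumes A: "A \<in> carrier_mat d d" and ut: "upper_triangular A"
  shows "upper_triangular (A ^\<^sub>m k) \<and> (\<forall>i<d. (A ^\<^sub>m k) $$ (i, i) = A $$ (i, i) ^ k)"
proof (induction k)
  case 0
  then show ?case
    using A by auto
next
  case (Suc k)
  have Ak: "A ^\<^sub>m k \<in> carrier_mat d d"
    using A by (rule pow_carrier_mat)
  have prod: "(A ^\<^sub>m k * A) $$ (i, j) = (\<Sum>l=0..<d. (A ^\<^sub>m k) $$ (i, l) * A $$ (l, j))"
    if "i < d" "j < d" for i j
    using that A Ak by (auto simp: scalar_prod_def intro!: sum.cong)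
  have zero: "(A ^\<^sub>m k) $$ (i, l) * A $$ (l, j) = 0" if "i < d" "l < d" "l < i \<or> j < l" for i j l
    using that upper_triangularD[OF conjunct1[OF Suc.IH], of l i] upper_triangularD[OF ut, of j l] A Ak
    by auto
  have "(A ^\<^sub>m k * A) $$ (i, j) = 0" if "i < d" "j < i" for i j
    unfolding prod[OF that(1) less_trans[OF that(2,1)]]
    by (rule sum.neutral) (use that zero in \<open>auto, metis le_less_trans not_le\<close>)
  moreover have "(A ^\<^sub>m k * A) $$ (i, i) = A $$ (i, i) ^ Suc k" if "i < d" for i
  proof -
    have "(A ^\<^sub>m k * A) $$ (i, i) = (\<Sum>l\<in>{i}. (A ^\<^sub>m k) $$ (i, l) * A $$ (l, i))"
      unfolding prod[OF that that]
      by (rule sum.mono_neutral_right) (use that zero in \<open>auto, metis linorder_neqE_nat\<close>)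
    then show ?thesis
      using Suc.IH that by (simp add: power_commutes)
  qed
  ultimately show ?case
    using A Ak by (auto simp: upper_triangular_def)
qed

text \<open>Cyclicity of the trace moves \<open>Q\<close> to the front, where it cancels against
  \<open>P\<close>.\<close>

lemma trace_conj:
  fixes B :: "'a::comm_semiring_1 mat"
  assumes "B \<in> carrier_mat d d" "P \<in> carrier_mat d d" "Q \<in> carrier_mat d d" "Q * P = 1\<^sub>m d"
  shows "(\<Sum>i<d. (P * B * Q) $$ (i, i)) = (\<Sum>i<d. B $$ (i, i))"
proof -
  have tr: "(\<Sum>i<d. (M * Q) $$ (i, i)) = (\<Sum>i<d. (Q * M) $$ (i, i))"
    if M: "M \<in> carrier_mat d d" for M
  proof -
    have "(\<Sum>i<d. (M * Q) $$ (i, i)) = (\<Sum>i<d. \<Sum>l=0..<d. M $$ (i, l) * Q $$ (l, i))"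
      using M assms(3) by (auto simp: scalar_prod_def intro!: sum.cong)
    also have "\<dots> = (\<Sum>l<d. \<Sum>i=0..<d. Q $$ (l, i) * M $$ (i, l))"
      unfolding lessThan_atLeast0 by (subst sum.swap) (simp add: mult.commute)
    also have "\<dots> = (\<Sum>l<d. (Q * M) $$ (l, l))"
      using M assms(3) by (auto simp: scalar_prod_def intro!: sum.cong)
    finally show ?thesis .
  qed
  have "Q * (P * B) = B"
    using assms by (simp flip: assoc_mult_mat[of Q d d P d B d])
  then show ?thesis
    using tr[of "P * B"] assms by simp
qed

text \<open>A Schur triangularization \<open>A = P * B * Q\<close> has the eigenvalues of
  \<open>A\<close> on the diagonal of \<open>B\<close>, and taking powers of \<open>B\<close> takes
  powers of these entries. Undoing the conjugation in \<open>A ^ N = 1\<close> gives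
  \<open>B ^ N = 1\<close>, so the eigenvalues are roots of unity.\<close>

lemma trace_pow_eq_sum_eigenvalues:
  fixes A :: "complex mat"
  assumes A: "A \<in> carrier_mat d d" and unity: "A ^\<^sub>m N = 1\<^sub>m d"
  obtains ev where "\<And>i. i < d \<Longrightarrow> ev i ^ N = 1"
    "\<And>k. (\<Sum>i<d. (A ^\<^sub>m k) $$ (i, i)) = (\<Sum>i<d. ev i ^ k)"
proof -
  obtain es where es: "char_poly A = (\<Prod>a\<leftarrow>es. [:- a, 1:])"
    using char_poly_factorized[OF A] by auto
  obtain B where B: "B \<in> carrier_mat d d" "upper_triangular B" "similar_mat A B"
    using schur_decomposition_exists[OF A es] by auto
  then obtain P Q where wit: "similar_mat_wit A B P Q"
    by (auto simp: similar_mat_def)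
  note PQ = similar_mat_witD2[OF A wit]
  note pow = similar_mat_wit_pow_id[OF wit] upper_triangular_pow[OF B(1,2)]
  have Bk: "B ^\<^sub>m k \<in> carrier_mat d d" for k
    using B(1) by (rule pow_carrier_mat)
  have "Q * (P * B ^\<^sub>m N * Q) * P = Q * (P * B ^\<^sub>m N) * (Q * P)"
    using PQ(6,7) Bk[of N] by (simp add: assoc_mult_mat[of _ d d _ d _ d])
  also have "Q * (P * B ^\<^sub>m N) = (Q * P) * B ^\<^sub>m N"
    using PQ(6,7) Bk[of N] by (simp add: assoc_mult_mat[of _ d d _ d _ d])
  finally have "Q * (P * B ^\<^sub>m N * Q) * P = (Q * P) * B ^\<^sub>m N * (Q * P)" .
  then have "B ^\<^sub>m N = 1\<^sub>m d"
    unfolding pow(1)[of N, symmetric] unity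
    using PQ(2,6,7) Bk[of N] left_mult_one_mat[OF Bk[of N]] right_mult_one_mat[OF Bk[of N]] by simp
  then have "B $$ (i, i) ^ N = 1" if "i < d" for i
    using pow(2)[of N] that by (metis index_one_mat(1))
  moreover have "(\<Sum>i<d. (A ^\<^sub>m k) $$ (i, i)) = (\<Sum>i<d. B $$ (i, i) ^ k)" for k
    using trace_conj[OF Bk PQ(6,7,2), of k] pow(1)[of k] pow(2)[of k] by simp
  ultimately show ?thesis
    by (rule that)
qed

section \<open>Conjugacy of a permutation with its coprime powers\<close>

text \<open>As \<open>k\<close> is invertible modulo \<open>N\<close>, \<open>\<sigma> ^^ k\<close>
  has the same orbits as \<open>\<sigma>\<close>. On an orbit with base point \<open>rep x\<close>,
  \<open>\<tau>\<close> sends the point with exponent \<open>e\<close> to the point with exponent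
  \<open>k * e\<close>, which turns a step of \<open>\<sigma>\<close> into a step of
  \<open>\<sigma> ^^ k\<close>.\<close>

lemma permutes_conj_coprime_power:
  assumes \<sigma>: "\<sigma> permutes S" "finite S" and N: "\<sigma> ^^ N = id" "N > 0" and k: "coprime k N"
  obtains \<tau> where "\<tau> permutes S" "\<tau> \<circ> \<sigma> = \<sigma> ^^ k \<circ> \<tau>"
proof -
  have inj: "inj (\<sigma> ^^ i)" for i
    using permutes_inj[OF permutes_funpow[OF \<sigma>(1)]] .
  have per: "\<sigma> ^^ i = \<sigma> ^^ j" if "[i = j] (mod N)" for i j
  proof -
    have "\<sigma> ^^ i = \<sigma> ^^ (i mod N)" for i
    proof -
      have "\<sigma> ^^ i = \<sigma> ^^ (i mod N) \<circ> (\<sigma> ^^ N) ^^ (i div N)"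
        by (simp flip: funpow_add add: funpow_mult)
      then show ?thesis
        by (simp add: N)
    qed
    then show ?thesis
      using that unfolding cong_def by metis
  qed
  obtain k' where k': "[k * k' = 1] (mod N)"
    using cong_solve_coprime_nat[OF k] by auto
  \<comment> \<open>Multiplying exponents respects equality of points, so the value of
    \<open>\<tau>\<close> will not depend on the exponent chosen to reach a point. With the
    multiplier \<open>k'\<close> the same fact gives injectivity.\<close>
  have fix_mult_le: "(\<sigma> ^^ (l * i)) x = (\<sigma> ^^ (l * j)) x"
    if "i \<le> j" "(\<sigma> ^^ i) x = (\<sigma> ^^ j) x" for l i j x
  proof -
    have "(\<sigma> ^^ i) ((\<sigma> ^^ (j - i)) x) = (\<sigma> ^^ i) x"
      using that by (simp flip: funpow_add comp_apply[of "_ ^^ _"])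
    then have fixp: "(\<sigma> ^^ (j - i)) x = x"
      using inj by (metis injD)
    have "(\<sigma> ^^ (l * (j - i))) x = x"
      by (induction l) (simp_all add: funpow_add fixp)
    moreover have "\<sigma> ^^ (l * j) = \<sigma> ^^ (l * i) \<circ> \<sigma> ^^ (l * (j - i))"
      using that by (simp flip: funpow_add add_mult_distrib2)
    ultimately show ?thesis
      by simp
  qed
  have fix_mult: "(\<sigma> ^^ (l * i)) x = (\<sigma> ^^ (l * j)) x"
    if "(\<sigma> ^^ i) x = (\<sigma> ^^ j) x" for l i j x
    using that fix_mult_le by (metis nle_le)
  define orb where "orb x = range (\<lambda>i. (\<sigma> ^^ i) x)" for x
  \<comment> \<open>Modulo \<open>N\<close> the exponent \<open>(N - 1) * i\<close> is the negative
    of \<open>i\<close>.\<close>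
  have return: "(\<sigma> ^^ ((N - 1) * i)) ((\<sigma> ^^ i) x) = x" for i x
  proof -
    have "(N - 1) * i + i = N * i"
      using N(2) by (cases N) auto
    then have "\<sigma> ^^ ((N - 1) * i) \<circ> \<sigma> ^^ i = \<sigma> ^^ (N * i)"
      by (simp flip: funpow_add)
    also have "\<dots> = \<sigma> ^^ 0"
      by (rule per) (simp add: cong_def)
    finally show ?thesis
      by (metis comp_apply funpow_0)
  qed
  have orb_sub: "orb ((\<sigma> ^^ i) x) \<subseteq> orb x" for i x
    by (auto simp: orb_def simp flip: funpow_add comp_apply[of "_ ^^ _"])
  have orb_pow: "orb ((\<sigma> ^^ i) x) = orb x" for i x
    using orb_sub[of i x] orb_sub[of "(N - 1) * i" "(\<sigma> ^^ i) x"] return[of i x] by auto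
  \<comment> \<open>The choice is made from the orbit as a set, so all points of an orbit share one
    base point.\<close>
  define rep where "rep x = (SOME y. y \<in> orb x)" for x
  have "x \<in> orb x" for x
    unfolding orb_def by (rule range_eqI[of _ _ 0]) simp
  then have rep_orb: "rep x \<in> orb x" for x
    unfolding rep_def by (rule someI)
  have "\<exists>i. (\<sigma> ^^ i) (rep x) = x" for x
  proof -
    obtain i where "rep x = (\<sigma> ^^ i) x"
      using rep_orb[of x] by (auto simp: orb_def)
    then show ?thesis
      using return[of i x] by (intro exI[of _ "(N - 1) * i"]) simp
  qed
  then obtain e where e: "(\<sigma> ^^ e x) (rep x) = x" for x
    by metis
  define \<tau> where "\<tau> x = (\<sigma> ^^ (k * e x)) (rep x)" for x
  have orb_\<tau>: "orb (\<tau> x) = orb x" for x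
    using orb_pow[of "e x" "rep x"] by (simp add: \<tau>_def orb_pow e)
  have rep_pow: "rep ((\<sigma> ^^ i) x) = rep x" for i x
    by (simp add: rep_def orb_pow)
  have comm: "\<tau> (\<sigma> x) = (\<sigma> ^^ k) (\<tau> x)" for x
  proof -
    have rep: "rep (\<sigma> x) = rep x"
      using rep_pow[of 1] by simp
    then have "(\<sigma> ^^ e (\<sigma> x)) (rep x) = (\<sigma> ^^ Suc (e x)) (rep x)"
      using e[of x] e[of "\<sigma> x"] by simp
    then have "(\<sigma> ^^ (k * e (\<sigma> x))) (rep x) = (\<sigma> ^^ (k * Suc (e x))) (rep x)"
      by (rule fix_mult)
    then show ?thesis
      unfolding \<tau>_def rep by (simp add: funpow_add)
  qed
  have inj_\<tau>: "inj \<tau>"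
  proof (rule injI)
    fix x x'
    assume eq: "\<tau> x = \<tau> x'"
    then have rep: "rep x = rep x'"
      by (metis orb_\<tau> rep_def)
    have "(\<sigma> ^^ (k' * (k * e x))) (rep x) = (\<sigma> ^^ (k' * (k * e x'))) (rep x)"
      by (rule fix_mult) (use eq rep \<tau>_def in metis)
    moreover have "\<sigma> ^^ (k' * (k * i)) = \<sigma> ^^ i" for i
      by (rule per) (use cong_scalar_right[OF k', of i] in \<open>simp add: mult_ac\<close>)
    ultimately show "x = x'"
      using e rep by metis
  qed
  have fixed: "\<tau> x = x" if "x \<notin> S" for x
  proof -
    have "(\<sigma> ^^ i) x = x" for i
      using permutes_not_in[OF permutes_funpow[OF \<sigma>(1)] that] .
    moreover have "rep x = x"
      using rep_orb[of x] calculation by (auto simp: orb_def)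
    ultimately show ?thesis
      by (simp add: \<tau>_def)
  qed
  have "\<tau> ` S \<subseteq> S"
    using inj_\<tau> fixed by (metis image_subsetI injD)
  then have "bij_betw \<tau> S S"
    using endo_inj_surj[OF \<sigma>(2)] inj_on_subset[OF inj_\<tau>] by (auto simp: bij_betw_def)
  then have "\<tau> permutes S"
    using fixed by (rule bij_imp_permutes)
  moreover have "\<tau> \<circ> \<sigma> = \<sigma> ^^ k \<circ> \<tau>"
    using comm by auto
  ultimately show ?thesis
    by (rule that)
qed

text \<open>All powers of \<open>\<sigma>\<close> with exponent prime to \<open>N\<close> are
  conjugate to \<open>\<sigma>\<close> and have the same trace. Summing over these exponents gives a
  positive multiple of that trace on one side and one Ramanujan sum for each eigenvalue on the
  other.\<close>

lemma character_Rats: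
  assumes \<rho>: "is_representation n d \<rho>" and \<sigma>: "\<sigma> \<in> Sym n"
  shows "(\<Sum>i<d. \<rho> \<sigma> $$ (i, i)) \<in> \<rat>"
proof -
  have perm: "\<sigma> permutes {1..n}"
    using \<sigma> by (simp add: Sym_def)
  have carrier: "\<rho> \<tau> \<in> carrier_mat d d" if "\<tau> permutes {1..n}" for \<tau>
    using \<rho> that by (auto simp: is_representation_def Sym_def)
  have mult: "\<rho> (\<tau> \<circ> \<upsilon>) = \<rho> \<tau> * \<rho> \<upsilon>" if "\<tau> permutes {1..n}" "\<upsilon> permutes {1..n}" for \<tau> \<upsilon>
    using \<rho> that by (auto simp: is_representation_def Sym_def)
  have id: "\<rho> id = 1\<^sub>m d"
    using \<rho> by (auto simp: is_representation_def)
  have pow: "\<rho> (\<sigma> ^^ k) = \<rho> \<sigma> ^\<^sub>m k" for k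
  proof (induction k)
    case 0
    then show ?case
      using carrier[OF perm] by (simp add: id_def id[unfolded id_def])
  next
    case (Suc k)
    have "\<rho> (\<sigma> ^^ Suc k) = \<rho> (\<sigma> ^^ k \<circ> \<sigma>)"
      by (simp only: funpow_Suc_right)
    then show ?case
      by (simp only: mult[OF permutes_funpow[OF perm] perm] Suc pow_mat.simps)
  qed
  obtain N where N: "\<sigma> ^^ N = id" "N > 0"
    using permutation_is_nilpotent permutation_permutes perm finite_atLeastAtMost by metis
  obtain ev where ev: "\<And>i. i < d \<Longrightarrow> ev i ^ N = 1"
    "\<And>k. (\<Sum>i<d. (\<rho> \<sigma> ^\<^sub>m k) $$ (i, i)) = (\<Sum>i<d. ev i ^ k)"
    using trace_pow_eq_sum_eigenvalues[OF carrier[OF perm], of N] pow[of N] id N by auto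
  let ?t = "\<Sum>i<d. \<rho> \<sigma> $$ (i, i)"
  let ?K = "{k. k \<in> {1..N} \<and> coprime k N}"
  have "(\<Sum>i<d. ev i ^ k) = ?t" if k: "coprime k N" for k
  proof -
    obtain \<tau> where \<tau>: "\<tau> permutes {1..n}" "\<tau> \<circ> \<sigma> = \<sigma> ^^ k \<circ> \<tau>"
      using permutes_conj_coprime_power[OF perm _ N k] by auto
    note inv = permutes_inv[OF \<tau>(1)]
    have "\<sigma> ^^ k = \<tau> \<circ> \<sigma> \<circ> inv_into UNIV \<tau>"
      by (simp add: \<tau> comp_assoc permutes_inv_o[OF \<tau>(1)])
    then have "\<rho> \<sigma> ^\<^sub>m k = \<rho> \<tau> * \<rho> \<sigma> * \<rho> (inv_into UNIV \<tau>)"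
      using mult[OF permutes_compose[OF perm \<tau>(1)] inv] mult[OF \<tau>(1) perm] pow[of k] by simp
    moreover have "\<rho> (inv_into UNIV \<tau>) * \<rho> \<tau> = 1\<^sub>m d"
      using mult[OF inv \<tau>(1)] id by (simp add: permutes_inv_o[OF \<tau>(1)])
    ultimately show ?thesis
      using trace_conj[OF carrier[OF perm] carrier[OF \<tau>(1)] carrier[OF inv]] ev(2)[of k] by simp
  qed
  then have "of_nat (card ?K) * ?t = (\<Sum>k\<in>?K. \<Sum>i<d. ev i ^ k)"
    by simp
  also have "\<dots> = (\<Sum>i<d. \<Sum>k\<in>?K. ev i ^ k)"
    by (rule sum.swap)
  also have "\<dots> \<in> \<rat>"
    by (intro Rats_sum sum_coprime_powers_root_of_unity_Rats) (use N ev in auto)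
  finally have "of_nat (card ?K) * ?t \<in> \<rat>" .
  moreover have "1 \<in> ?K"
    using N by auto
  then have "card ?K \<noteq> 0"
    by auto
  ultimately show ?thesis
    by (metis (no_types, lifting) Rats_divide Rats_of_nat nonzero_mult_div_cancel_left of_nat_eq_0_iff)
qed

text \<open>On rational values \<open>rat_scalar\<close> is the embedding of the prime field, which
  is injective.\<close>

lemma rat_scalar_character_nonzero:
  assumes "is_nonzero_character n \<chi>" "\<sigma> \<in> Sym n"
  shows "rat_scalar (\<chi> \<sigma>) \<noteq> (0 :: 'a::field_char_0)"
proof -
  have "\<chi> \<sigma> \<in> \<rat>" "\<chi> \<sigma> \<noteq> 0"
    using assms character_Rats by (auto simp: is_nonzero_character_def)
  then show ?thesis
    by (auto elim!: Rats_cases)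
qed


section \<open>Jacobians for the Euler operators\<close>

text \<open>The derivation \<open>x \<partial>/\<partial>x\<close>.\<close>

definition euler :: "'v \<Rightarrow> ('v, 'a::comm_ring_1) mpoly \<Rightarrow> ('v, 'a) mpoly" where
  "euler x p = Poly_Mapping.mapp (\<lambda>m c. of_nat (Poly_Mapping.lookup m x) * c) p"

lemma lookup_euler:
  "Poly_Mapping.lookup (euler x p) m = of_nat (Poly_Mapping.lookup m x) * Poly_Mapping.lookup p m"
  by (simp add: euler_def lookup_mapp when_def in_keys_iff)

lemma keys_euler: "Poly_Mapping.keys (euler x p) \<subseteq> Poly_Mapping.keys p"
  unfolding euler_def by (rule keys_mapp_subset)

lemma euler_0 [simp]: "euler x 0 = 0"
  by (rule poly_mapping_eqI) (simp add: lookup_euler)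

lemma euler_add: "euler x (p + q) = euler x p + euler x q"
  by (rule poly_mapping_eqI) (simp add: lookup_euler lookup_add distrib_left)

lemma euler_sum: "euler x (sum f I) = (\<Sum>i\<in>I. euler x (f i))"
  by (induction I rule: infinite_finite_induct) (simp_all add: euler_add)

lemma euler_single:
  "euler x (Poly_Mapping.single m a) = Poly_Mapping.single m (of_nat (Poly_Mapping.lookup m x) * a)"
  by (rule poly_mapping_eqI) (simp add: lookup_euler lookup_single when_def)

lemma euler_mconst [simp]: "euler x (mconst a) = 0"
  by (simp add: mconst_def euler_single)

lemma euler_1 [simp]: "euler x 1 = 0"
  using euler_mconst[of x 1] by (simp add: mconst_def)

lemma sum_single_keys:
  "p = (\<Sum>m\<in>Poly_Mapping.keys p. Poly_Mapping.single m (Poly_Mapping.lookup p m))"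
  by (rule poly_mapping_eqI) (simp add: lookup_sum lookup_single when_def sum.delta' in_keys_iff)

lemma euler_mult: "euler x (p * q) = euler x p * q + p * euler x q"
proof -
  have mono: "euler x (Poly_Mapping.single m a * Poly_Mapping.single l b) =
      euler x (Poly_Mapping.single m a) * Poly_Mapping.single l b +
      Poly_Mapping.single m a * euler x (Poly_Mapping.single l b)" for m l and a b :: 'b
    by (simp add: euler_single mult_single lookup_add algebra_simps flip: single_add)
  define s where "s p m = Poly_Mapping.single m (Poly_Mapping.lookup p m)" for p :: "('a, 'b) mpoly" and m
  have s: "p = sum (s p) (Poly_Mapping.keys p)" for p
    unfolding s_def by (rule sum_single_keys)
  have "euler x (sum (s p) I * sum (s q) J) =
      euler x (sum (s p) I) * sum (s q) J + sum (s p) I * euler x (sum (s q) J)" for I J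
    unfolding sum_product euler_sum
    by (simp add: s_def mono sum.distrib)
  then show ?thesis
    using s by metis
qed

text \<open>The logarithmic derivative of a monomial in the elements of \<open>B\<close>, multiplied
  by the product of \<open>B\<close>. This clears the denominators and avoids the truncated
  exponents \<open>e b - 1\<close>.\<close>

lemma euler_prod_power:
  assumes "finite B"
  shows "euler x (\<Prod>b\<in>B. b ^ e b) * \<Prod>B =
    (\<Sum>b\<in>B. of_nat (e b) * (\<Prod>b\<in>B. b ^ e b) * \<Prod>(B - {b}) * euler x b)"
  using assms
proof (induction B rule: finite_induct)
  case empty
  then show ?case
    by simp
next
  case (insert c B)
  let ?P = "\<Prod>b\<in>B. b ^ e b"
  have pow: "euler x (c ^ k) * c = of_nat k * c ^ k * euler x c" for k
  proof (induction k)
    case 0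
    show ?case
      by simp
  next
    case (Suc k)
    have "euler x (c ^ Suc k) * c = euler x c * c ^ k * c + c * (euler x (c ^ k) * c)"
      by (simp add: euler_mult algebra_simps)
    then show ?case
      unfolding Suc by (simp add: algebra_simps)
  qed
  have B: "insert c B - {b} = insert c (B - {b})" if "b \<in> B" for b
    using that insert.hyps by auto
  have "euler x (c ^ e c * ?P) * (c * \<Prod>B) =
      (euler x (c ^ e c) * c) * ?P * \<Prod>B + c ^ e c * c * (euler x ?P * \<Prod>B)"
    by (simp add: euler_mult algebra_simps)
  also have "\<dots> = of_nat (e c) * (c ^ e c * ?P) * \<Prod>B * euler x c +
      (\<Sum>b\<in>B. of_nat (e b) * (c ^ e c * ?P) * (c * \<Prod>(B - {b})) * euler x b)"
    unfolding pow insert.IH by (simp add: sum_distrib_left algebra_simps)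
  also have "\<dots> = (\<Sum>b\<in>insert c B. of_nat (e b) * (c ^ e c * ?P) * \<Prod>(insert c B - {b}) * euler x b)"
    using insert.hyps by (simp add: B cong: sum.cong)
  finally show ?case
    using insert.hyps by simp
qed

text \<open>
  Take a relation with the fewest monomials.  If each \<open>b \<partial>/\<partial>b\<close> turned it into another relation, then
  eliminating one monomial would show that only one monomial is left.
\<close>

lemma dependent_imp_euler_relation:
  fixes R :: "(('v::linorder, 'a::field_char_0) mpoly, 'a) mpoly"
  assumes B: "finite B" and R: "R \<noteq> 0" "indets R \<subseteq> B" "subst (\<lambda>g. g) R = 0"
  obtains v b0 where "b0 \<in> B" "v b0 \<noteq> 0" "\<And>x. (\<Sum>b\<in>B. v b * euler x b) = 0"
proof (cases "0 \<in> B")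
  \<comment> \<open>Since \<open>euler x 0 = 0\<close>, the coefficients supported at
    \<open>0\<close> already work. In the other case products of elements of \<open>B\<close> are
    nonzero.\<close>
  case True
  show ?thesis
    by (rule that[OF True, of "\<lambda>b. if b = 0 then 1 else 0"]) (auto intro!: sum.neutral)
next
  case False
  define rel where "rel R \<longleftrightarrow> R \<noteq> 0 \<and> indets R \<subseteq> B \<and> subst (\<lambda>g. g) R = 0"
    for R :: "(('v, 'a) mpoly, 'a) mpoly"
  define Q where "Q = (ARG_MIN (\<lambda>R. card (Poly_Mapping.keys R)) R. rel R)"
  have "rel R"
    using R by (simp add: rel_def)
  then have Q: "rel Q"
    and min: "\<And>R'. rel R' \<Longrightarrow> card (Poly_Mapping.keys Q) \<le> card (Poly_Mapping.keys R')"
    using arg_min_nat_lemma[of rel R "\<lambda>R. card (Poly_Mapping.keys R)"] unfolding Q_def by blast+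
  obtain m0 where m0: "m0 \<in> Poly_Mapping.keys Q"
    using Q unfolding rel_def by (metis all_not_in_conv keys_eq_empty)
  define M where "M m = (\<Prod>b\<in>B. b ^ Poly_Mapping.lookup m b)" for m :: "('v, 'a) mpoly \<Rightarrow>\<^sub>0 nat"
  \<comment> \<open>Sums and products are put over the fixed index sets \<open>K\<close> and
    \<open>B\<close>, so that different relations can be compared term by term.\<close>
  have subst: "subst (\<lambda>g. g) R' = (\<Sum>m\<in>K. mconst (Poly_Mapping.lookup R' m) * M m)"
    if "indets R' \<subseteq> B" "Poly_Mapping.keys R' \<subseteq> K" "finite K" for R' K
  proof -
    have "subst (\<lambda>g. g) R' = (\<Sum>m\<in>Poly_Mapping.keys R'. mconst (Poly_Mapping.lookup R' m) * M m)"
      unfolding subst_def M_def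
    proof (intro sum.cong refl arg_cong2[where f = "(*)"] prod.mono_neutral_left B)
      fix m
      assume "m \<in> Poly_Mapping.keys R'"
      then show "Poly_Mapping.keys m \<subseteq> B"
        using that(1) by (auto simp: indets_def)
    qed (auto simp: in_keys_iff)
    also have "\<dots> = (\<Sum>m\<in>K. mconst (Poly_Mapping.lookup R' m) * M m)"
      by (rule sum.mono_neutral_left) (use that in \<open>auto simp: in_keys_iff mconst_def\<close>)
    finally show ?thesis .
  qed
  let ?K = "Poly_Mapping.keys Q"
  \<comment> \<open>This is \<open>b \<partial>Q/\<partial>b\<close>, evaluated at the elements of
    \<open>B\<close>.\<close>
  define S where "S b = (\<Sum>m\<in>?K. of_nat (Poly_Mapping.lookup m b) * mconst (Poly_Mapping.lookup Q m) * M m)" for b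
  have zero: "(\<Sum>m\<in>?K. mconst (Poly_Mapping.lookup Q m) * M m) = 0"
    using Q subst[of Q ?K] by (simp add: rel_def)
  have "\<exists>b\<in>B. S b \<noteq> 0"
  proof (rule ccontr)
    assume "\<not> ?thesis"
    then have S0: "S b = 0" if "b \<in> B" for b
      using that by auto
    have same: "Poly_Mapping.lookup m b = Poly_Mapping.lookup m0 b" if b: "b \<in> B" and m: "m \<in> ?K" for m b
    proof (rule ccontr)
      assume neq: "Poly_Mapping.lookup m b \<noteq> Poly_Mapping.lookup m0 b"
      \<comment> \<open>Subtracting from \<open>b \<partial>Q/\<partial>b\<close> the multiple of
        \<open>Q\<close> that cancels \<open>m0\<close> gives a relation with fewer monomials. It is
        nonzero because distinct exponents stay distinct in characteristic zero.\<close>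
      define R' where "R' = Poly_Mapping.mapp
        (\<lambda>m c. (of_nat (Poly_Mapping.lookup m b) - of_nat (Poly_Mapping.lookup m0 b)) * c) Q"
      have lookup: "Poly_Mapping.lookup R' m =
          (of_nat (Poly_Mapping.lookup m b) - of_nat (Poly_Mapping.lookup m0 b)) * Poly_Mapping.lookup Q m" for m
        by (simp add: R'_def lookup_mapp when_def in_keys_iff)
      have keys: "Poly_Mapping.keys R' \<subseteq> ?K"
        unfolding R'_def by (rule keys_mapp_subset)
      have "m \<in> Poly_Mapping.keys R'"
        using m neq by (simp add: in_keys_iff lookup)
      then have "R' \<noteq> 0"
        by auto
      have ind: "indets R' \<subseteq> B"
        using keys Q by (auto simp: indets_def rel_def)
      have "subst (\<lambda>g. g) R' = (\<Sum>m\<in>?K. mconst (Poly_Mapping.lookup R' m) * M m)"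
        by (rule subst) (use ind keys in auto)
      also have "\<dots> = (\<Sum>m\<in>?K. of_nat (Poly_Mapping.lookup m b) * mconst (Poly_Mapping.lookup Q m) * M m
          - of_nat (Poly_Mapping.lookup m0 b) * (mconst (Poly_Mapping.lookup Q m) * M m))"
      proof (rule sum.cong[OF refl])
        fix m
        have "mconst (Poly_Mapping.lookup R' m) =
            (of_nat (Poly_Mapping.lookup m b) - of_nat (Poly_Mapping.lookup m0 b)) *
            (mconst (Poly_Mapping.lookup Q m) :: ('v, 'a) mpoly)"
          unfolding lookup mconst_def
          by (simp add: mult_single flip: single_of_nat single_diff)
        then show "mconst (Poly_Mapping.lookup R' m) * M m =
            of_nat (Poly_Mapping.lookup m b) * mconst (Poly_Mapping.lookup Q m) * M m
            - of_nat (Poly_Mapping.lookup m0 b) * (mconst (Poly_Mapping.lookup Q m) * M m)"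
          by (simp add: left_diff_distrib mult.assoc)
      qed
      also have "\<dots> = S b - of_nat (Poly_Mapping.lookup m0 b) *
          (\<Sum>m\<in>?K. mconst (Poly_Mapping.lookup Q m) * M m)"
        by (simp add: S_def sum_subtractf sum_distrib_left)
      also have "\<dots> = 0"
        using zero S0[OF b] by simp
      finally have "rel R'"
        using \<open>R' \<noteq> 0\<close> ind by (simp add: rel_def)
      then have "card ?K \<le> card (Poly_Mapping.keys R')"
        by (rule min)
      then have "Poly_Mapping.keys R' = ?K"
        using keys by (simp add: card_seteq)
      moreover have "m0 \<notin> Poly_Mapping.keys R'"
        by (simp add: in_keys_iff lookup)
      ultimately show False
        using m0 by simp
    qed
    \<comment> \<open>A relation with the single monomial \<open>m0\<close> says that a nonzero
      constant times a product of nonzero elements is zero, which is impossible in an integral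
      domain.\<close>
    have "?K = {m0}"
    proof -
      have "m = m0" if m: "m \<in> ?K" for m
      proof (rule poly_mapping_eqI)
        fix b
        show "Poly_Mapping.lookup m b = Poly_Mapping.lookup m0 b"
        proof (cases "b \<in> B")
          case True
          then show ?thesis
            using same m by simp
        next
          case False
          then have "b \<notin> Poly_Mapping.keys m" "b \<notin> Poly_Mapping.keys m0"
            using Q m m0 by (auto simp: rel_def indets_def)
          then show ?thesis
            by (simp add: in_keys_iff)
        qed
      qed
      then show ?thesis
        using m0 by blast
    qed
    then have "mconst (Poly_Mapping.lookup Q m0) * M m0 = 0"
      using zero by simp
    moreover have "M m0 \<noteq> 0"
      using False B by (auto simp: M_def)
    moreover have "mconst (Poly_Mapping.lookup Q m0) \<noteq> (0 :: ('v, 'a) mpoly)"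
      using m0 by (metis in_keys_iff lookup_single_eq lookup_zero mconst_def)
    ultimately show False
      by simp
  qed
  then obtain b0 where b0: "b0 \<in> B" "S b0 \<noteq> 0"
    by blast
  \<comment> \<open>Applying \<open>euler x\<close> to the relation produces the coefficients
    \<open>S b / b\<close>; the product removes the denominators.\<close>
  define v where "v b = S b * \<Prod>(B - {b})" for b
  have "v b0 \<noteq> 0"
    using b0 False B by (auto simp: v_def)
  moreover have "(\<Sum>b\<in>B. v b * euler x b) = 0" for x
  proof -
    have "0 = euler x (\<Sum>m\<in>?K. mconst (Poly_Mapping.lookup Q m) * M m) * \<Prod>B"
      by (simp add: zero)
    also have "\<dots> = (\<Sum>m\<in>?K. mconst (Poly_Mapping.lookup Q m) * (euler x (M m) * \<Prod>B))"
      by (simp add: euler_sum euler_mult sum_distrib_right mult.assoc)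
    also have "\<dots> = (\<Sum>m\<in>?K. \<Sum>b\<in>B. mconst (Poly_Mapping.lookup Q m) *
        (of_nat (Poly_Mapping.lookup m b) * M m * \<Prod>(B - {b}) * euler x b))"
      unfolding M_def euler_prod_power[OF B] sum_distrib_left ..
    also have "\<dots> = (\<Sum>b\<in>B. v b * euler x b)"
      unfolding v_def S_def sum_distrib_right by (subst sum.swap) (simp add: algebra_simps)
    finally show ?thesis
      by simp
  qed
  ultimately show ?thesis
    using that b0(1) by blast
qed

lemma card_le_trdeg:
  assumes "finite A" "B \<subseteq> A" "alg_independent B"
  shows "card B \<le> trdeg A"
proof -
  have "{card B | B. B \<subseteq> A \<and> alg_independent B} \<subseteq> {..card A}"
    using assms(1) by (auto intro: card_mono)
  then have "finite {card B | B. B \<subseteq> A \<and> alg_independent B}"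
    by (rule finite_subset) simp
  then show ?thesis
    unfolding trdeg_def by (rule Max_ge) (use assms in auto)
qed

section \<open>Minors of the Jacobian\<close>

text \<open>The determinant is an ordinary Jacobian minor times the product of the chosen variables.
  Polynomials and variables may repeat.\<close>

definition jacobian :: "nat \<Rightarrow> (nat \<Rightarrow> ('v, 'a::comm_ring_1) mpoly) \<Rightarrow> (nat \<Rightarrow> 'v) \<Rightarrow> ('v, 'a) mpoly mat" where
  "jacobian k b x = mat k k (\<lambda>(i, j). euler (x j) (b i))"

lemma jacobian_carrier [simp]: "jacobian k b x \<in> carrier_mat k k"
  by (simp add: jacobian_def)

text \<open>A repeated polynomial gives equal rows. Otherwise the polynomials are algebraically
  dependent, and the coefficients of the differentiated relation are the same for all variables, so
  they form a dependency among the rows. The order on the variables provides the integral domain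
  structure that such an argument needs.\<close>

lemma det_jacobian_eq_0:
  fixes A :: "('v::linorder, 'a::field_char_0) mpoly set"
  assumes A: "finite A" "b ` {..<k} \<subseteq> A" "trdeg A < k"
  shows "det (jacobian k b x) = 0"
proof (cases "inj_on b {..<k}")
  case False
  then obtain i j where ij: "i < k" "j < k" "i \<noteq> j" "b i = b j"
    by (auto simp: inj_on_def)
  have "row (jacobian k b x) i = row (jacobian k b x) j"
    using ij by (intro eq_vecI) (auto simp: jacobian_def)
  then show ?thesis
    using det_identical_rows[OF jacobian_carrier ij(3,1,2)] by blast
next
  case True
  let ?B = "b ` {..<k}"
  have "card ?B = k"
    using True by (simp add: card_image)
  then have "\<not> alg_independent ?B"
    using card_le_trdeg[OF A(1,2)] A(3) by auto
  then obtain R :: "(('v, 'a) mpoly, 'a) mpoly" where R: "R \<noteq> 0" "indets R \<subseteq> ?B" "subst (\<lambda>g. g) R = 0"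
    by (auto simp: alg_independent_def)
  obtain b0 v where v: "b0 \<in> ?B" "v b0 \<noteq> 0" "\<And>x. (\<Sum>b\<in>?B. v b * euler x b) = 0"
    by (rule dependent_imp_euler_relation[OF _ R]) auto
  let ?J = "transpose_mat (jacobian k b x)"
  let ?v = "vec k (\<lambda>i. v (b i))"
  have "?J *\<^sub>v ?v = 0\<^sub>v k"
  proof (rule eq_vecI)
    fix j
    assume "j < dim_vec (0\<^sub>v k :: ('v, 'a) mpoly vec)"
    then have j: "j < k"
      by simp
    have "(?J *\<^sub>v ?v) $ j = (\<Sum>i=0..<k. euler (x j) (b i) * v (b i))"
      using j by (simp add: jacobian_def scalar_prod_def)
    also have "\<dots> = (\<Sum>b\<in>?B. v b * euler (x j) b)"
      by (simp add: sum.reindex[OF True] atLeast0LessThan mult.commute)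
    finally show "(?J *\<^sub>v ?v) $ j = 0\<^sub>v k $ j"
      using v(3) j by simp
  qed (simp add: jacobian_def)
  moreover have "?v \<noteq> 0\<^sub>v k"
  proof -
    obtain i where "i < k" "b0 = b i"
      using v(1) by auto
    then show ?thesis
      using v(2) by (metis index_vec index_zero_vec(1))
  qed
  ultimately have "det ?J = 0"
    using det_0_iff_vec_prod_zero[of ?J k] by (metis jacobian_carrier transpose_carrier_mat vec_carrier)
  then show ?thesis
    using det_transpose[OF jacobian_carrier] by metis
qed

text \<open>Each Leibniz term multiplies one \<open>euler\<close> image of every \<open>b i\<close>,
  and these images have no new exponents. The right-hand side depends neither on the permutation nor
  on \<open>x\<close>, so one count serves all column choices.\<close>

lemma keys_det_jacobian:
  "Poly_Mapping.keys (det (jacobian k b x)) \<subseteq>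
    (\<lambda>g. \<Sum>i<k. g i) ` (\<Pi>\<^sub>E i\<in>{..<k}. Poly_Mapping.keys (b i))"
proof -
  let ?T = "\<lambda>I. (\<lambda>g. \<Sum>i\<in>I. g i) ` (\<Pi>\<^sub>E i\<in>I. Poly_Mapping.keys (b i))"
  have keys_prod: "Poly_Mapping.keys (\<Prod>i\<in>I. euler (x (p i)) (b i)) \<subseteq> ?T I" if "finite I" for I p
    using that
  proof (induction I rule: finite_induct)
    case empty
    then show ?case
      by simp
  next
    case (insert j I)
    show ?case
    proof
      fix m
      assume "m \<in> Poly_Mapping.keys (\<Prod>i\<in>insert j I. euler (x (p i)) (b i))"
      then have "m \<in> Poly_Mapping.keys (euler (x (p j)) (b j) * (\<Prod>i\<in>I. euler (x (p i)) (b i)))"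
        using insert.hyps by simp
      then obtain l l' where "m = l + l'" "l \<in> Poly_Mapping.keys (euler (x (p j)) (b j))"
        and l': "l' \<in> Poly_Mapping.keys (\<Prod>i\<in>I. euler (x (p i)) (b i))"
        using keys_mult by blast
      moreover obtain g where "l' = (\<Sum>i\<in>I. g i)" "g \<in> (\<Pi>\<^sub>E i\<in>I. Poly_Mapping.keys (b i))"
        using insert.IH l' by blast
      ultimately have l: "m = l + (\<Sum>i\<in>I. g i)" "l \<in> Poly_Mapping.keys (b j)"
        "g \<in> (\<Pi>\<^sub>E i\<in>I. Poly_Mapping.keys (b i))"
        using subsetD[OF keys_euler] by auto
      have "(\<Sum>i\<in>I. (g(j := l)) i) = (\<Sum>i\<in>I. g i)"
        by (rule sum.cong) (use insert in auto)
      then have "m = (\<Sum>i\<in>insert j I. (g(j := l)) i)"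
        using insert l by simp
      moreover have "g(j := l) \<in> (\<Pi>\<^sub>E i\<in>insert j I. Poly_Mapping.keys (b i))"
        using l(2,3) by (auto simp: PiE_def extensional_def)
      ultimately show "m \<in> ?T (insert j I)"
        by blast
    qed
  qed
  have "det (jacobian k b x) = (\<Sum>p | p permutes {..<k}. signof p * (\<Prod>i\<in>{..<k}. euler (x (p i)) (b i)))"
    unfolding det_def'[OF jacobian_carrier] atLeast0LessThan
  proof (intro sum.cong prod.cong arg_cong2[where f = "(*)"] refl)
    fix p i
    assume "p \<in> {p. p permutes {..<k}}" "i \<in> {..<k}"
    then have "i < k" "p i < k"
      using permutes_in_image[of p "{..<k}" i] by auto
    then show "jacobian k b x $$ (i, p i) = euler (x (p i)) (b i)"
      by (simp add: jacobian_def)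
  qed
  also have "Poly_Mapping.keys \<dots> \<subseteq> (\<Union>p\<in>{p. p permutes {..<k}}.
      Poly_Mapping.keys (signof p * (\<Prod>i\<in>{..<k}. euler (x (p i)) (b i))))"
    by (rule keys_sum)
  also have "\<dots> \<subseteq> (\<Union>p\<in>{p. p permutes {..<k}}. Poly_Mapping.keys (\<Prod>i\<in>{..<k}. euler (x (p i)) (b i)))"
  proof (rule UN_mono[OF subset_refl])
    fix p
    show "Poly_Mapping.keys (signof p * (\<Prod>i\<in>{..<k}. euler (x (p i)) (b i)))
        \<subseteq> Poly_Mapping.keys (\<Prod>i\<in>{..<k}. euler (x (p i)) (b i))"
      by (cases p rule: sign_cases) simp_all
  qed
  also have "\<dots> \<subseteq> ?T {..<k}"
    using keys_prod by blast
  finally show ?thesis .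
qed

text \<open>Laplace expansion along the new row. The coefficients do not involve \<open>p\<close>,
  so the bordered minor is a derivation in \<open>p\<close>.\<close>

lemma det_jacobian_Suc:
  "det (jacobian (Suc k) (b(k := p)) y) =
    (\<Sum>i\<le>k. (-1) ^ (k + i) * det (jacobian k b (y \<circ> insert_index i)) * euler (y i) p)"
proof -
  let ?J = "jacobian (Suc k) (b(k := p)) y"
  have "det ?J = (\<Sum>i<Suc k. ?J $$ (k, i) * cofactor ?J k i)"
    by (rule laplace_expansion_row) auto
  also have "\<dots> = (\<Sum>i\<le>k. (-1) ^ (k + i) * det (jacobian k b (y \<circ> insert_index i)) * euler (y i) p)"
    unfolding lessThan_Suc_atMost
  proof (rule sum.cong[OF refl])
    fix i
    assume i: "i \<in> {..k}"
    have "mat_delete ?J k i = jacobian k b (y \<circ> insert_index i)"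
      using i by (intro eq_matI) (auto simp: mat_delete_def jacobian_def insert_index_def)
    then show "?J $$ (k, i) * cofactor ?J k i =
        (-1) ^ (k + i) * det (jacobian k b (y \<circ> insert_index i)) * euler (y i) p"
      using i by (simp add: cofactor_def jacobian_def)
  qed
  finally show ?thesis .
qed

section \<open>Derivations along circuits\<close>

lemma gate_values_snoc:
  "gate_values (C @ [g]) f = gate_values C f @ [gate_value f (gate_values C f) g]"
  by (simp add: gate_values_def)

lemma length_gate_values [simp]: "length (gate_values C f) = length C"
  by (induction C rule: rev_induct) (simp_all add: gate_values_snoc, simp add: gate_values_def)

text \<open>The kernel of a derivation that kills the constants is a subalgebra; once it contains
  the inputs, it contains the value of every gate.\<close>

lemma derivation_circuit_output_eq_0:
  fixes D :: "('v, 'a::comm_ring_1) mpoly \<Rightarrow> ('v, 'a) mpoly"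
  assumes add: "\<And>p q. D (p + q) = D p + D q"
    and mult: "\<And>p q. D (p * q) = D p * q + p * D q"
    and const: "\<And>a. D (mconst a) = 0"
    and inp: "\<And>i. i \<in> {1..m} \<Longrightarrow> D (f i) = 0"
    and C: "is_circuit m C"
  shows "D (circuit_output C f) = 0"
proof -
  have "D (mconst 0) = 0" "D (mconst 1) = 0"
    by (rule const)+
  then have D01: "D 0 = 0" "D 1 = 0"
    by (simp_all add: mconst_def)
  have D_list: "D (sum_list ps) = 0" "D (prod_list ps) = 0" if "\<forall>p\<in>set ps. D p = 0" for ps
    using that by (induction ps) (simp_all add: D01 add mult)
  have "\<forall>p\<in>set (gate_values C f). D p = 0" if "\<forall>k<length C. gate_ok m k (C ! k)" for C
    using that
  proof (induction C rule: rev_induct)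
    case Nil
    then show ?case
      by (simp add: gate_values_def)
  next
    case (snoc g C)
    have "gate_ok m k (C ! k)" if "k < length C" for k
      using snoc.prems[rule_format, of k] that by (simp add: nth_append)
    then have IH: "\<forall>p\<in>set (gate_values C f). D p = 0"
      using snoc.IH by blast
    have ok: "gate_ok m (length C) g"
      using snoc.prems[rule_format, of "length C"] by simp
    have sub: "D (gate_values C f ! j) = 0" if "set js \<subseteq> {..<length C}" "j \<in> set js" for js j
      using that IH by (auto intro!: nth_mem)
    have "D (gate_value f (gate_values C f) g) = 0"
      using ok by (cases g) (auto intro!: inp const D_list sub)
    then show ?case
      using IH by (simp add: gate_values_snoc)
  qed
  moreover have "gate_values C f \<noteq> []"
    using C by (metis is_circuit_def length_0_conv length_gate_values)
  ultimately show ?thesis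
    using C unfolding circuit_output_def is_circuit_def by (meson last_in_set)
qed


section \<open>Unique factorization of block permutation monomials\<close>

text \<open>
  Coordinates are processed in turn.  One that is constant on the remaining set costs nothing;
  otherwise the smaller of its maximal and minimal faces is kept, which forces the bit.
\<close>

lemma ex_uniquely_decodable:
  fixes u :: "'m \<Rightarrow> nat \<Rightarrow> nat"
  assumes "finite F" "F \<noteq> {}"
  shows "\<exists>\<mu>\<in>F. \<exists>D\<subseteq>{..<N}. \<exists>h :: nat \<Rightarrow> bool. 2 ^ card D \<le> card F \<and>
    (\<forall>\<nu>\<in>F. \<forall>\<epsilon> \<epsilon>'. (\<forall>i\<in>D. \<epsilon> i = h i) \<longrightarrow>
      (\<forall>i<N. u \<mu> i + of_bool (\<epsilon> i) = u \<nu> i + of_bool (\<epsilon>' i)) \<longrightarrow> (\<forall>i<N. \<epsilon> i = \<epsilon>' i))"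
  using assms
proof (induction N arbitrary: F)
  case 0
  then have "card F \<ge> 1"
    by (simp add: Suc_le_eq card_gt_0_iff)
  then show ?case
    using 0 by auto
next
  case (Suc N)
  define A where "A = {\<mu>\<in>F. u \<mu> N = Max ((\<lambda>\<mu>. u \<mu> N) ` F)}"
  define B where "B = {\<mu>\<in>F. u \<mu> N = Min ((\<lambda>\<mu>. u \<mu> N) ` F)}"
  have fin: "finite ((\<lambda>\<mu>. u \<mu> N) ` F)" "(\<lambda>\<mu>. u \<mu> N) ` F \<noteq> {}"
    using Suc.prems by auto
  have bounds: "Min ((\<lambda>\<mu>. u \<mu> N) ` F) \<le> u \<mu> N" "u \<mu> N \<le> Max ((\<lambda>\<mu>. u \<mu> N) ` F)"
    if "\<mu> \<in> F" for \<mu>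
    using fin that by auto
  obtain a b where "a \<in> F" "u a N = Max ((\<lambda>\<mu>. u \<mu> N) ` F)" "b \<in> F" "u b N = Min ((\<lambda>\<mu>. u \<mu> N) ` F)"
    using Max_in[OF fin] Min_in[OF fin] by (metis (no_types, lifting) imageE)
  then have AB: "finite A" "A \<noteq> {}" "A \<subseteq> F" "finite B" "B \<noteq> {}" "B \<subseteq> F"
    using Suc.prems by (auto simp: A_def B_def)
  show ?case
  proof (cases "A \<inter> B = {}")
    \<comment> \<open>A common element of both faces means that maximum and minimum agree. The
      coordinate is then constant, and equal sums have equal bits.\<close>
    case False
    then have const: "u \<mu> N = u \<nu> N" if "\<mu> \<in> F" "\<nu> \<in> F" for \<mu> \<nu>
      using bounds[OF that(1)] bounds[OF that(2)] by (auto simp: A_def B_def)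
    obtain \<mu> D h where IH: "\<mu> \<in> F" "D \<subseteq> {..<N}" "2 ^ card D \<le> card F"
      "\<forall>\<nu>\<in>F. \<forall>\<epsilon> \<epsilon>'. (\<forall>i\<in>D. \<epsilon> i = h i) \<longrightarrow>
        (\<forall>i<N. u \<mu> i + of_bool (\<epsilon> i) = u \<nu> i + of_bool (\<epsilon>' i)) \<longrightarrow> (\<forall>i<N. \<epsilon> i = \<epsilon>' i)"
      using Suc.IH[OF Suc.prems] by (elim bexE exE conjE) (rule that)
    show ?thesis
    proof (intro bexI[OF _ IH(1)] exI[of _ D] exI[of _ h] conjI ballI allI impI)
      fix \<nu> \<epsilon> \<epsilon>' i
      assume *: "\<nu> \<in> F" "\<forall>i\<in>D. \<epsilon> i = h i"
        "\<forall>i<Suc N. u \<mu> i + of_bool (\<epsilon> i) = u \<nu> i + of_bool (\<epsilon>' i)" "i < Suc N"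
      have "\<forall>i<N. \<epsilon> i = \<epsilon>' i"
        using * by (intro IH(4)[THEN bspec, THEN spec, THEN spec, THEN mp, THEN mp]) auto
      moreover have "\<epsilon> N = \<epsilon>' N"
        using spec[OF *(3), of N] const[OF IH(1) *(1)] by (simp add: of_bool_def split: if_splits)
      ultimately show "\<epsilon> i = \<epsilon>' i"
        using *(4) by (auto simp: less_Suc_eq)
    qed (use IH in auto)
  next
    case True
    \<comment> \<open>The smaller of two disjoint faces has at most half of the elements, which pays
      for one more fixed bit.\<close>
    then have "card A + card B \<le> card F"
      using AB Suc.prems by (metis Un_subset_iff card_Un_disjoint card_mono)
    then have "2 * card A \<le> card F \<or> 2 * card B \<le> card F"
      by linarith
    then obtain E t where E: "2 * card E \<le> card F" "E = A \<and> t \<or> E = B \<and> \<not> t"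
      by blast
    then have E': "finite E" "E \<noteq> {}" "E \<subseteq> F"
      using AB by auto
    obtain \<mu> D h where IH: "\<mu> \<in> E" "D \<subseteq> {..<N}" "2 ^ card D \<le> card E"
      "\<forall>\<nu>\<in>E. \<forall>\<epsilon> \<epsilon>'. (\<forall>i\<in>D. \<epsilon> i = h i) \<longrightarrow>
        (\<forall>i<N. u \<mu> i + of_bool (\<epsilon> i) = u \<nu> i + of_bool (\<epsilon>' i)) \<longrightarrow> (\<forall>i<N. \<epsilon> i = \<epsilon>' i)"
      using Suc.IH[OF E'(1,2)] by (elim bexE exE conjE) (rule that)
    have "N \<notin> D" "finite D"
      using IH(2) finite_subset by auto
    then have card: "2 ^ card (insert N D) \<le> card F"
      using IH(3) E(1) by simp
    show ?thesis
    proof (intro bexI[of _ \<mu>] exI[of _ "insert N D"] exI[of _ "h(N := t)"] conjI ballI allI impI)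
      fix \<nu> \<epsilon> \<epsilon>' i
      assume *: "\<nu> \<in> F" "\<forall>i\<in>insert N D. \<epsilon> i = (h(N := t)) i"
        "\<forall>i<Suc N. u \<mu> i + of_bool (\<epsilon> i) = u \<nu> i + of_bool (\<epsilon>' i)" "i < Suc N"
      have N: "u \<mu> N + of_bool t = u \<nu> N + of_bool (\<epsilon>' N)" "\<epsilon> N = t"
        using *(2,3) by auto
      \<comment> \<open>On the maximal face with bit 1 the sum is the largest possible, on the
        minimal face with bit 0 the smallest possible. Equality therefore puts \<open>\<nu>\<close>
        on the same face and forces the bit of \<open>\<epsilon>'\<close>.\<close>
      have "\<nu> \<in> E \<and> \<epsilon>' N = t"
        using E(2)
      proof
        assume "E = A \<and> t"
        then show ?thesis
          using N(1) bounds[OF *(1)] IH(1) *(1) by (cases "\<epsilon>' N") (auto simp: A_def)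
      next
        assume "E = B \<and> \<not> t"
        then show ?thesis
          using N(1) bounds[OF *(1)] IH(1) *(1) by (cases "\<epsilon>' N") (auto simp: B_def)
      qed
      moreover have "\<forall>i\<in>D. \<epsilon> i = h i"
        using *(2) \<open>N \<notin> D\<close> by auto
      ultimately have "\<forall>i<N. \<epsilon> i = \<epsilon>' i" "\<epsilon> N = \<epsilon>' N"
        using IH(4)[THEN bspec, of \<nu>, THEN spec, THEN spec, of \<epsilon> \<epsilon>'] *(3) N(2) by auto
      then show "\<epsilon> i = \<epsilon>' i"
        using *(4) by (auto simp: less_Suc_eq)
    qed (use IH E' card in auto)
  qed
qed

section \<open>Permutations preserving the diagonal blocks\<close>

definition perm_monomial :: "nat \<Rightarrow> (nat \<Rightarrow> nat) \<Rightarrow> (nat \<times> nat \<Rightarrow>\<^sub>0 nat)" where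
  "perm_monomial n \<sigma> = (\<Sum>i=1..n. Poly_Mapping.single (i, \<sigma> i) 1)"

lemma lookup_perm_monomial:
  "Poly_Mapping.lookup (perm_monomial n \<sigma>) (i, j) = of_bool (i \<in> {1..n} \<and> \<sigma> i = j)"
proof -
  have "Poly_Mapping.lookup (perm_monomial n \<sigma>) (i, j) = (\<Sum>l=1..n. of_bool (l = i \<and> \<sigma> i = j))"
    unfolding perm_monomial_def Poly_Mapping.lookup_sum
    by (rule sum.cong) (auto simp: lookup_single when_def)
  also have "\<dots> = (\<Sum>l=1..n. if l = i then of_bool (\<sigma> i = j) else 0)"
    by (rule sum.cong) auto
  finally show ?thesis
    by (auto simp: sum.delta)
qed

text \<open>Indices count from 1, so block \<open>i\<close> consists of \<open>2 * i + 1\<close> and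
  \<open>2 * i + 2\<close>. Truncated subtraction also places \<open>0\<close> in block
  \<open>0\<close>.\<close>

definition same_block :: "nat \<Rightarrow> nat \<Rightarrow> bool" where
  "same_block p q \<longleftrightarrow> (p - 1) div 2 = (q - 1) div 2"

text \<open>A true bit leaves its block fixed and a false one swaps it, so the bit is the exponent
  of the variable \<open>(2 * i + 1, 2 * i + 1)\<close>. For odd \<open>n\<close> the last index is
  fixed.\<close>

definition block_perm :: "nat \<Rightarrow> (nat \<Rightarrow> bool) \<Rightarrow> nat \<Rightarrow> nat" where
  "block_perm n \<epsilon> p = (if p \<in> {1..2 * (n div 2)} \<and> \<not> \<epsilon> ((p - 1) div 2)
     then if odd p then p + 1 else p - 1 else p)"

lemma block_perm_involution: "block_perm n \<epsilon> (block_perm n \<epsilon> p) = p"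
proof -
  have "even p \<Longrightarrow> p > 0 \<Longrightarrow> (p - Suc 0 - Suc 0) div 2 = (p - Suc 0) div 2"
    by presburger
  moreover have "odd p \<Longrightarrow> p div 2 = (p - Suc 0) div 2"
    by presburger
  moreover have "odd p \<Longrightarrow> p \<le> 2 * (n div 2) \<Longrightarrow> Suc p \<le> 2 * (n div 2)"
    by presburger
  ultimately show ?thesis
    by (auto simp: block_perm_def)
qed

lemma block_perm_in_Sym: "block_perm n \<epsilon> \<in> Sym n"
proof -
  have "block_perm n \<epsilon> p \<in> {1..n}" if "p \<in> {1..n}" for p
  proof -
    have "odd p \<Longrightarrow> p \<le> 2 * (n div 2) \<Longrightarrow> Suc p \<le> n"
      by presburger
    then show ?thesis
      using that by (auto simp: block_perm_def elim!: evenE)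
  qed
  then have "bij_betw (block_perm n \<epsilon>) {1..n} {1..n}"
    by (intro bij_betw_byWitness[where f' = "block_perm n \<epsilon>"]) (auto simp: block_perm_involution)
  moreover have "block_perm n \<epsilon> p = p" if "p \<notin> {1..n}" for p
    using that by (auto simp: block_perm_def)
  ultimately show ?thesis
    unfolding Sym_def by (auto intro: bij_imp_permutes)
qed

lemma same_block_block_perm: "same_block p (block_perm n \<epsilon> p)"
proof -
  have "even p \<Longrightarrow> p > 0 \<Longrightarrow> (p - Suc 0 - Suc 0) div 2 = (p - Suc 0) div 2"
    by presburger
  moreover have "odd p \<Longrightarrow> p div 2 = (p - Suc 0) div 2"
    by presburger
  ultimately show ?thesis
    by (auto simp: same_block_def block_perm_def)
qed

lemma block_perm_fixes_odd:
  "i < n div 2 \<Longrightarrow> block_perm n \<epsilon> (2 * i + 1) = 2 * i + 1 \<longleftrightarrow> \<epsilon> i"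
  by (auto simp: block_perm_def)

lemma same_block_cases:
  assumes "same_block p q" "p = 2 * i + 1 \<or> p = 2 * i + 2" "1 \<le> q"
  shows "q = 2 * i + 1 \<or> q = 2 * i + 2"
proof -
  have "(q - 1) div 2 = i"
    using assms(1,2) by (auto simp: same_block_def)
  then have "q - 1 = 2 * i + (q - 1) mod 2"
    by (metis mult_div_mod_eq)
  then show ?thesis
    using assms(3) by (cases "even (q - 1)") (auto simp: even_iff_mod_2_eq_zero odd_iff_mod_2_eq_one)
qed

text \<open>On a block of two elements only the identity and the swap are possible, and the image of
  the odd element tells them apart.\<close>

lemma same_block_perm_eqI:
  assumes \<sigma>: "\<sigma> \<in> Sym n" "\<And>p. p \<in> {1..n} \<Longrightarrow> same_block p (\<sigma> p)"
    and \<tau>: "\<tau> \<in> Sym n" "\<And>p. p \<in> {1..n} \<Longrightarrow> same_block p (\<tau> p)"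
    and eq: "\<And>i. i < n div 2 \<Longrightarrow> \<sigma> (2 * i + 1) = 2 * i + 1 \<longleftrightarrow> \<tau> (2 * i + 1) = 2 * i + 1"
  shows "\<sigma> = \<tau>"
proof -
  have range: "\<pi> p \<in> {1..n}" if "\<pi> \<in> Sym n" "p \<in> {1..n}" for \<pi> p
    using that by (metis Sym_def mem_Collect_eq permutes_in_image)
  have odd: "\<pi> (2 * i + 1) = 2 * i + 1 \<or> \<pi> (2 * i + 1) = 2 * i + 2 \<and> i < n div 2"
    if "\<pi> \<in> Sym n" "2 * i + 1 \<le> n" "same_block (2 * i + 1) (\<pi> (2 * i + 1))" for \<pi> i
  proof -
    have "1 \<le> \<pi> (2 * i + 1)" "\<pi> (2 * i + 1) \<le> n"
      using range[OF that(1), of "2 * i + 1"] that(2) by auto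
    moreover have "2 * i + 2 \<le> n \<Longrightarrow> i < n div 2"
      by simp
    ultimately show ?thesis
      using same_block_cases[OF that(3), of i] by fastforce
  qed
  have even: "\<pi> (2 * i + 2) = (if \<pi> (2 * i + 1) = 2 * i + 1 then 2 * i + 2 else 2 * i + 1)"
    if "\<pi> \<in> Sym n" "2 * i + 2 \<le> n" "\<And>p. p \<in> {1..n} \<Longrightarrow> same_block p (\<pi> p)" for \<pi> i
  proof -
    have "\<pi> (2 * i + 2) = 2 * i + 1 \<or> \<pi> (2 * i + 2) = 2 * i + 2"
      using that(3)[of "2 * i + 2", THEN same_block_cases, of i] range[OF that(1), of "2 * i + 2"] that(2)
      by simp
    moreover have "\<pi> (2 * i + 1) = 2 * i + 1 \<or> \<pi> (2 * i + 1) = 2 * i + 2"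
      using odd[OF that(1) _ that(3), of i] that(2) by fastforce
    moreover have "\<pi> (2 * i + 1) \<noteq> \<pi> (2 * i + 2)"
      using inj_eq[OF permutes_inj, of \<pi> "{1..n}" "2 * i + 1" "2 * i + 2"] that(1)
      by (simp add: Sym_def)
    ultimately show ?thesis
      by presburger
  qed
  have odd_eq: "\<sigma> (2 * i + 1) = \<tau> (2 * i + 1)" if "2 * i + 1 \<le> n" for i
  proof -
    have p: "2 * i + 1 \<in> {1..n}"
      using that by simp
    show ?thesis
      using odd[OF \<sigma>(1) that \<sigma>(2)[OF p]] odd[OF \<tau>(1) that \<tau>(2)[OF p]] eq[of i] by metis
  qed
  have even_eq: "\<sigma> (2 * i + 2) = \<tau> (2 * i + 2)" if "2 * i + 2 \<le> n" for i
    using even[OF \<sigma>(1) that \<sigma>(2)] even[OF \<tau>(1) that \<tau>(2)] odd_eq[of i] that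
    by (metis Suc_eq_plus1 Suc_leD add_2_eq_Suc')
  have "\<sigma> p = \<tau> p" for p
  proof (cases "p \<in> {1..n}")
    case True
    then obtain l where "p = Suc l"
      by (cases p) auto
    then obtain i where "p = 2 * i + 1 \<or> p = 2 * i + 2"
      by (metis add_2_eq_Suc' evenE oddE Suc_eq_plus1)
    then show ?thesis
      using odd_eq[of i] even_eq[of i] True by auto
  next
    case False
    then show ?thesis
      using \<sigma>(1) \<tau>(1) by (simp add: Sym_def permutes_not_in)
  qed
  then show ?thesis
    by auto
qed

text \<open>First only exponents of least degree outside the blocks are kept, which forces
  \<open>\<tau>\<close> to preserve the blocks. The diagonal exponents then turn the claim into
  unique decoding of bits.\<close>

lemma ex_isolated_products:
  fixes T :: "(nat \<times> nat \<Rightarrow>\<^sub>0 nat) set"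
  assumes T: "finite T" "T \<noteq> {}"
  obtains \<mu> D h where "\<mu> \<in> T" "D \<subseteq> {..<n div 2}" "2 ^ card D \<le> card T"
    "\<And>\<epsilon> \<nu> \<tau>. \<lbrakk>\<forall>i\<in>D. \<epsilon> i = h i; \<nu> \<in> T; \<tau> \<in> Sym n;
       \<mu> + perm_monomial n (block_perm n \<epsilon>) = \<nu> + perm_monomial n \<tau>\<rbrakk> \<Longrightarrow> \<tau> = block_perm n \<epsilon>"
proof -
  define Z where "Z = {(p, q). p \<in> {1..n} \<and> q \<in> {1..n} \<and> \<not> same_block p q}"
  define w where "w m = (\<Sum>z\<in>Z. Poly_Mapping.lookup m z)" for m :: "nat \<times> nat \<Rightarrow>\<^sub>0 nat"
  have "Z \<subseteq> {1..n} \<times> {1..n}"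
    by (auto simp: Z_def)
  then have Z: "finite Z"
    by (rule finite_subset) simp
  have w_add: "w (a + b) = w a + w b" for a b
    by (simp add: w_def lookup_add sum.distrib)
  define F where "F = {\<mu>\<in>T. w \<mu> = Min (w ` T)}"
  obtain a where "a \<in> T" "w a = Min (w ` T)"
    using T Min_in[of "w ` T"] by (metis (no_types, lifting) finite_imageI imageE image_is_empty)
  then have F: "finite F" "F \<noteq> {}" "F \<subseteq> T"
    using T by (auto simp: F_def)
  obtain \<mu> D h where *: "\<mu> \<in> F" "D \<subseteq> {..<n div 2}" "2 ^ card D \<le> card F"
    and raw: "\<forall>\<nu>\<in>F. \<forall>\<epsilon> \<epsilon>'. (\<forall>i\<in>D. \<epsilon> i = h i) \<longrightarrow>
      (\<forall>i<n div 2. Poly_Mapping.lookup \<mu> (2 * i + 1, 2 * i + 1) + of_bool (\<epsilon> i) =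
        Poly_Mapping.lookup \<nu> (2 * i + 1, 2 * i + 1) + of_bool (\<epsilon>' i)) \<longrightarrow>
      (\<forall>i<n div 2. \<epsilon> i = \<epsilon>' i)"
    using ex_uniquely_decodable[OF F(1,2), of "n div 2"
        "\<lambda>m i. Poly_Mapping.lookup m (2 * i + 1, 2 * i + 1)"]
    by (elim bexE exE conjE) (rule that)
  show ?thesis
  proof (rule that)
    show "\<mu> \<in> T" "D \<subseteq> {..<n div 2}"
      using * F by auto
    show "2 ^ card D \<le> card T"
      using *(3) card_mono[OF T(1) F(3)] by simp
    fix \<epsilon> \<nu> \<tau>
    assume \<epsilon>: "\<forall>i\<in>D. \<epsilon> i = h i" and \<nu>: "\<nu> \<in> T" and \<tau>: "\<tau> \<in> Sym n"
      and eq: "\<mu> + perm_monomial n (block_perm n \<epsilon>) = \<nu> + perm_monomial n \<tau>"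
    \<comment> \<open>A block permutation has weight \<open>0\<close> and \<open>\<mu>\<close> has
      least weight, so the equation leaves no weight for \<open>\<tau>\<close> and makes the weight
      of \<open>\<nu>\<close> minimal too.\<close>
    have "w (perm_monomial n (block_perm n \<epsilon>)) = 0"
      unfolding w_def using same_block_block_perm
      by (intro sum.neutral) (auto simp: lookup_perm_monomial Z_def)
    then have "w \<mu> = w \<nu> + w (perm_monomial n \<tau>)"
      using arg_cong[OF eq, of w] by (simp add: w_add)
    moreover have "w \<mu> \<le> w \<nu>"
      using * \<nu> T by (auto simp: F_def)
    ultimately have w0: "w (perm_monomial n \<tau>) = 0" and "w \<nu> = w \<mu>"
      by auto
    then have "\<nu> \<in> F"
      using * \<nu> by (auto simp: F_def)
    have block: "same_block p (\<tau> p)" if p: "p \<in> {1..n}" for p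
    proof (rule ccontr)
      assume "\<not> same_block p (\<tau> p)"
      moreover have "\<tau> p \<in> {1..n}"
        using \<tau> p by (metis Sym_def mem_Collect_eq permutes_in_image)
      ultimately have "(p, \<tau> p) \<in> Z"
        using p by (simp add: Z_def)
      then have "Poly_Mapping.lookup (perm_monomial n \<tau>) (p, \<tau> p) = 0"
        using w0 Z by (auto simp: w_def)
      then show False
        using p by (simp add: lookup_perm_monomial)
    qed
    have "\<forall>i<n div 2. \<epsilon> i = (\<tau> (2 * i + 1) = 2 * i + 1)"
    proof (rule raw[THEN bspec, OF \<open>\<nu> \<in> F\<close>, THEN spec, THEN spec, THEN mp, THEN mp, OF \<epsilon>], intro allI impI)
      fix i
      assume i: "i < n div 2"
      then have "2 * i + 1 \<in> {1..n}"
        by auto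
      then show "Poly_Mapping.lookup \<mu> (2 * i + 1, 2 * i + 1) + of_bool (\<epsilon> i) =
        Poly_Mapping.lookup \<nu> (2 * i + 1, 2 * i + 1) + of_bool (\<tau> (2 * i + 1) = 2 * i + 1)"
        using arg_cong[OF eq, of "\<lambda>m. Poly_Mapping.lookup m (2 * i + 1, 2 * i + 1)"]
          block_perm_fixes_odd[OF i, of \<epsilon>]
        by (simp add: lookup_add lookup_perm_monomial)
    qed
    then show "\<tau> = block_perm n \<epsilon>"
      using \<tau> block block_perm_in_Sym same_block_block_perm block_perm_fixes_odd
      by (intro same_block_perm_eqI[where n = n]) auto
  qed
qed


section \<open>The lower bound\<close>

text \<open>\<open>k\<close> is the rank of the Jacobian: the empty minor is \<open>1\<close>, and
  minors larger than the transcendence degree vanish.\<close>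

lemma ex_max_jacobian:
  fixes A :: "('v::linorder, 'a::field_char_0) mpoly set"
  assumes "finite A"
  obtains k b x where "k \<le> trdeg A" "b ` {..<k} \<subseteq> A" "det (jacobian k b x) \<noteq> 0"
    "\<And>b' x'. b' ` {..<Suc k} \<subseteq> A \<Longrightarrow> det (jacobian (Suc k) b' x') = 0"
proof -
  define P where "P k \<longleftrightarrow> (\<exists>b x. b ` {..<k} \<subseteq> A \<and> det (jacobian k b x) \<noteq> 0)" for k
  have "P 0"
    by (simp add: P_def)
  have bound: "k \<le> trdeg A" if "P k" for k
    using that det_jacobian_eq_0[OF assms, of _ k] unfolding P_def by (metis not_le)
  define k where "k = (GREATEST k. P k)"
  have "P k"
    unfolding k_def using \<open>P 0\<close> bound by (rule GreatestI_nat)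
  then obtain b x where bx: "b ` {..<k} \<subseteq> A" "det (jacobian k b x) \<noteq> 0"
    unfolding P_def by metis
  have "\<not> P (Suc k)"
  proof
    assume "P (Suc k)"
    then have "Suc k \<le> k"
      unfolding k_def using bound by (rule Greatest_le_nat)
    then show False
      by simp
  qed
  then have "det (jacobian (Suc k) b' x') = 0" if "b' ` {..<Suc k} \<subseteq> A" for b' x'
    using that unfolding P_def by metis
  with bound[OF \<open>P k\<close>] bx show ?thesis
    by (rule that)
qed

section \<open>Coefficients of the differentiated immanant\<close>

lemma immanant_eq_sum_single:
  "immanant n \<chi> = (\<Sum>\<sigma>\<in>Sym n. Poly_Mapping.single (perm_monomial n \<sigma>) (rat_scalar (\<chi> \<sigma>)))"
proof -
  have prod_single: "(\<Prod>i\<in>I. Poly_Mapping.single (Poly_Mapping.single (i, \<sigma> i) 1) 1) =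
      Poly_Mapping.single (\<Sum>i\<in>I. Poly_Mapping.single (i, \<sigma> i) 1) (1 :: 'a)"
    if "finite I" for I :: "nat set" and \<sigma> :: "nat \<Rightarrow> nat"
    using that by (induction I) (simp_all add: mult_single)
  show ?thesis
    by (simp only: immanant_def perm_monomial_def mconst_def prod_single[OF finite_atLeastAtMost]
        mult_single add_0 mult_1_right)
qed

lemma lookup_mult_single:
  fixes p :: "('v, 'a::comm_ring_1) mpoly"
  shows "Poly_Mapping.lookup (p * Poly_Mapping.single m a) (l + m) = Poly_Mapping.lookup p l * a"
proof -
  have "p * Poly_Mapping.single m a =
      (\<Sum>l\<in>Poly_Mapping.keys p. Poly_Mapping.single (l + m) (Poly_Mapping.lookup p l * a))"
    by (subst sum_single_keys[of p]) (simp add: sum_distrib_right mult_single)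
  then show ?thesis
    by (simp add: lookup_sum lookup_single when_def sum.delta' in_keys_iff)
qed

text \<open>By \<open>iso\<close>, the term of \<open>\<sigma>\<close> is the only one in the
  immanant that can contribute to this exponent.\<close>

lemma lookup_mult_euler_immanant:
  fixes c :: "(nat \<times> nat, 'a::field_char_0) mpoly"
  assumes \<sigma>: "\<sigma> \<in> Sym n"
    and iso: "\<And>\<nu> \<tau>. \<lbrakk>\<nu> \<in> Poly_Mapping.keys c; \<tau> \<in> Sym n;
      \<mu> + perm_monomial n \<sigma> = \<nu> + perm_monomial n \<tau>\<rbrakk> \<Longrightarrow> \<tau> = \<sigma>"
  shows "Poly_Mapping.lookup (c * euler y (immanant n \<chi>)) (\<mu> + perm_monomial n \<sigma>) =
    Poly_Mapping.lookup c \<mu> * of_nat (Poly_Mapping.lookup (perm_monomial n \<sigma>) y) * rat_scalar (\<chi> \<sigma>)"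
proof -
  let ?m = "perm_monomial n"
  let ?a = "\<lambda>\<tau>. of_nat (Poly_Mapping.lookup (?m \<tau>) y) * rat_scalar (\<chi> \<tau>) :: 'a"
  have fin: "finite (Sym n)"
    unfolding Sym_def by (rule finite_permutations) simp
  have "Poly_Mapping.lookup (c * euler y (immanant n \<chi>)) (\<mu> + ?m \<sigma>) =
      (\<Sum>\<tau>\<in>Sym n. Poly_Mapping.lookup (c * Poly_Mapping.single (?m \<tau>) (?a \<tau>)) (\<mu> + ?m \<sigma>))"
    by (simp add: immanant_eq_sum_single euler_sum euler_single sum_distrib_left lookup_sum)
  also have "\<dots> = (\<Sum>\<tau>\<in>{\<sigma>}. Poly_Mapping.lookup (c * Poly_Mapping.single (?m \<tau>) (?a \<tau>)) (\<mu> + ?m \<sigma>))"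
  proof (rule sum.mono_neutral_right[OF fin])
    show "\<forall>\<tau>\<in>Sym n - {\<sigma>}. Poly_Mapping.lookup (c * Poly_Mapping.single (?m \<tau>) (?a \<tau>)) (\<mu> + ?m \<sigma>) = 0"
    proof (rule ballI, rule ccontr)
      fix \<tau>
      assume \<tau>: "\<tau> \<in> Sym n - {\<sigma>}"
        and "Poly_Mapping.lookup (c * Poly_Mapping.single (?m \<tau>) (?a \<tau>)) (\<mu> + ?m \<sigma>) \<noteq> 0"
      then have "\<mu> + ?m \<sigma> \<in> Poly_Mapping.keys (c * Poly_Mapping.single (?m \<tau>) (?a \<tau>))"
        by (simp add: in_keys_iff)
      then obtain \<nu> l where "\<mu> + ?m \<sigma> = \<nu> + l" "\<nu> \<in> Poly_Mapping.keys c"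
        "l \<in> Poly_Mapping.keys (Poly_Mapping.single (?m \<tau>) (?a \<tau>))"
        using keys_mult by blast
      then show False
        using iso[of \<nu> \<tau>] \<tau> by (auto split: if_splits)
    qed
  qed (use \<sigma> in auto)
  also have "\<dots> = Poly_Mapping.lookup c \<mu> * of_nat (Poly_Mapping.lookup (?m \<sigma>) y) * rat_scalar (\<chi> \<sigma>)"
    by (simp add: lookup_mult_single mult.assoc)
  finally show ?thesis .
qed

section \<open>Bordered minors applied to the immanant\<close>

text \<open>The rows of the \<open>k\<close> variables of a largest nonzero minor meet at most
  \<open>k\<close> blocks. All other blocks turn out to lie in \<open>D\<close>, and
  \<open>2 ^ card D \<le> s ^ k\<close>.\<close>

lemma immanant_blocks_bound:
  fixes f :: "nat \<Rightarrow> (nat \<times> nat, 'a::field_char_0) mpoly"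
  assumes \<chi>: "is_nonzero_character n \<chi>" and C: "is_circuit m C"
    and s: "\<And>i. i \<in> {1..m} \<Longrightarrow> num_monomials (f i) \<le> s"
    and out: "circuit_output C f = immanant n \<chi>"
  obtains k where "k \<le> trdeg (f ` {1..m})" "2 ^ (n div 2 - k) \<le> s ^ k"
proof -
  obtain k b x0 where k: "k \<le> trdeg (f ` {1..m})" and b: "b ` {..<k} \<subseteq> f ` {1..m}"
    and x0: "det (jacobian k b x0) \<noteq> 0"
    and max: "\<And>b' x'. b' ` {..<Suc k} \<subseteq> f ` {1..m} \<Longrightarrow> det (jacobian (Suc k) b' x') = 0"
    by (rule ex_max_jacobian[OF finite_imageI[OF finite_atLeastAtMost]]) (rule that)
  \<comment> \<open>The cofactors of the bordered minor use different columns but the same rows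
    \<open>b\<close>, hence the union over all \<open>x\<close>.\<close>
  define T where "T = (\<Union>x. Poly_Mapping.keys (det (jacobian k b x)))"
  let ?S = "\<Pi>\<^sub>E i\<in>{..<k}. Poly_Mapping.keys (b i)"
  have finS: "finite ?S"
    by (rule finite_PiE) auto
  have T_sub: "T \<subseteq> (\<lambda>g. \<Sum>i<k. g i) ` ?S"
    unfolding T_def using keys_det_jacobian by blast
  then have finT: "finite T"
    using finS finite_surj by blast
  have "T \<noteq> {}"
    using x0 unfolding T_def by (metis UN_I UNIV_I empty_iff ex_in_conv keys_eq_empty)
  have "card T \<le> card ?S"
    using T_sub finS by (rule surj_card_le[rotated])
  also have "\<dots> = (\<Prod>i<k. card (Poly_Mapping.keys (b i)))"
    by (simp add: card_PiE)
  also have "\<dots> \<le> (\<Prod>i<k. s)"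
  proof (rule prod_mono)
    fix i
    assume "i \<in> {..<k}"
    then obtain j where "j \<in> {1..m}" "b i = f j"
      using b by blast
    then show "0 \<le> card (Poly_Mapping.keys (b i)) \<and> card (Poly_Mapping.keys (b i)) \<le> s"
      using s[of j] by (simp add: num_monomials_def)
  qed
  finally have cardT: "card T \<le> s ^ k"
    by simp
  obtain \<mu> D h where \<mu>: "\<mu> \<in> T" and D: "D \<subseteq> {..<n div 2}" "2 ^ card D \<le> card T"
    and iso: "\<And>\<epsilon> \<nu> \<tau>. \<lbrakk>\<forall>i\<in>D. \<epsilon> i = h i; \<nu> \<in> T; \<tau> \<in> Sym n;
       \<mu> + perm_monomial n (block_perm n \<epsilon>) = \<nu> + perm_monomial n \<tau>\<rbrakk> \<Longrightarrow> \<tau> = block_perm n \<epsilon>"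
    by (rule ex_isolated_products[OF finT \<open>T \<noteq> {}\<close>, of n]) blast
  obtain x where x: "\<mu> \<in> Poly_Mapping.keys (det (jacobian k b x))"
    using \<mu> by (auto simp: T_def)
  have "n div 2 \<le> card D + k"
  proof (rule ccontr)
    assume "\<not> ?thesis"
    moreover have "finite D"
      using D(1) finite_subset by blast
    moreover have "card ((\<lambda>j. (fst (x j) - 1) div 2) ` {..<k}) \<le> k"
      using card_image_le[of "{..<k}"] by simp
    ultimately have "card (D \<union> (\<lambda>j. (fst (x j) - 1) div 2) ` {..<k}) < card {..<n div 2}"
      using card_Un_le[of D "(\<lambda>j. (fst (x j) - 1) div 2) ` {..<k}"] by simp
    then have "\<not> {..<n div 2} \<subseteq> D \<union> (\<lambda>j. (fst (x j) - 1) div 2) ` {..<k}"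
      using \<open>finite D\<close> by (metis card_mono finite_UnI finite_imageI finite_lessThan not_le)
    \<comment> \<open>Flipping the bit of block \<open>i\<close> only moves its two rows, so the
      exponents of the variables \<open>x j\<close> stay unchanged.\<close>
    then obtain i where i: "i < n div 2" "i \<notin> D" "\<And>j. j < k \<Longrightarrow> (fst (x j) - 1) div 2 \<noteq> i"
      by auto
    \<comment> \<open>The added variable is the one whose exponent is the bit of block
      \<open>i\<close>.\<close>
    define y where "y = x(k := (2 * i + 1, 2 * i + 1))"
    define c where "c j = (-1) ^ (k + j) * det (jacobian k b (y \<circ> insert_index j))" for j
    define \<Delta> where "\<Delta> p = (\<Sum>j\<le>k. c j * euler (y j) p)" for p
    have \<Delta>: "\<Delta> p = det (jacobian (Suc k) (b(k := p)) y)" for p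
      by (simp add: \<Delta>_def c_def det_jacobian_Suc)
    \<comment> \<open>On an input, \<open>\<Delta>\<close> is a minor of size \<open>k + 1\<close>
      with rows among the \<open>f i\<close>, which vanishes by maximality of
      \<open>k\<close>.\<close>
    have "\<Delta> (circuit_output C f) = 0"
    proof (rule derivation_circuit_output_eq_0[OF _ _ _ _ C])
      fix i
      assume "i \<in> {1..m}"
      then show "\<Delta> (f i) = 0"
        unfolding \<Delta> using b by (intro max) (auto simp: lessThan_Suc)
    next
      fix p q
      show "\<Delta> (p + q) = \<Delta> p + \<Delta> q"
        by (simp add: \<Delta>_def euler_add distrib_left sum.distrib)
      have "\<Delta> (p * q) = (\<Sum>j\<le>k. c j * euler (y j) p * q + p * (c j * euler (y j) q))"
        unfolding \<Delta>_def by (intro sum.cong refl) (simp add: euler_mult algebra_simps)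
      then show "\<Delta> (p * q) = \<Delta> p * q + p * \<Delta> q"
        unfolding \<Delta>_def sum.distrib sum_distrib_left sum_distrib_right .
    qed (simp add: \<Delta>_def)
    then have \<Delta>0: "\<Delta> (immanant n \<chi>) = 0"
      by (simp add: out)
    have keys_c: "Poly_Mapping.keys (c j) \<subseteq> T" for j
    proof -
      have "Poly_Mapping.keys (c j) = Poly_Mapping.keys (det (jacobian k b (y \<circ> insert_index j)))"
        unfolding c_def by (cases "even (k + j)") simp_all
      then show ?thesis
        unfolding T_def by blast
    qed
    \<comment> \<open>Up to the character value, this is the coefficient of
      \<open>\<Delta> (immanant n \<chi>)\<close> at \<open>\<mu>\<close> plus the exponent of the
      block permutation.\<close>
    define L where "L \<epsilon> = (\<Sum>j\<le>k. Poly_Mapping.lookup (c j) \<mu> *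
        of_nat (Poly_Mapping.lookup (perm_monomial n (block_perm n \<epsilon>)) (y j)))" for \<epsilon>
    have L0: "L \<epsilon> = 0" if \<epsilon>: "\<forall>i\<in>D. \<epsilon> i = h i" for \<epsilon>
    proof -
      let ?\<sigma> = "block_perm n \<epsilon>"
      have "0 = Poly_Mapping.lookup (\<Delta> (immanant n \<chi>)) (\<mu> + perm_monomial n ?\<sigma>)"
        by (simp add: \<Delta>0)
      also have "\<dots> = (\<Sum>j\<le>k. Poly_Mapping.lookup (c j) \<mu> *
          of_nat (Poly_Mapping.lookup (perm_monomial n ?\<sigma>) (y j)) * rat_scalar (\<chi> ?\<sigma>))"
        unfolding \<Delta>_def lookup_sum
        using keys_c by (intro sum.cong lookup_mult_euler_immanant block_perm_in_Sym iso[OF \<epsilon>] refl) auto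
      also have "\<dots> = L \<epsilon> * rat_scalar (\<chi> ?\<sigma>)"
        by (simp add: L_def sum_distrib_right)
      finally show ?thesis
        using rat_scalar_character_nonzero[where 'a = 'a, OF \<chi> block_perm_in_Sym, of \<epsilon>] by simp
    qed
    have row: "block_perm n (h(i := t)) p = block_perm n h p" if "(p - 1) div 2 \<noteq> i" for p t
      using that by (simp add: block_perm_def)
    define S where "S = (\<Sum>j<k. Poly_Mapping.lookup (c j) \<mu> *
      of_nat (Poly_Mapping.lookup (perm_monomial n (block_perm n h)) (x j)))"
    have L_upd: "L (h(i := t)) = S + Poly_Mapping.lookup (c k) \<mu> * of_bool t" for t
    proof -
      have "Poly_Mapping.lookup (perm_monomial n (block_perm n (h(i := t)))) (y k) = of_bool t"
      proof -
        have "2 * i + 1 \<in> {1..n}"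
          using i(1) by auto
        then show ?thesis
          using block_perm_fixes_odd[OF i(1), of "h(i := t)"] by (simp add: y_def lookup_perm_monomial)
      qed
      moreover have "(\<Sum>j<k. Poly_Mapping.lookup (c j) \<mu> *
            of_nat (Poly_Mapping.lookup (perm_monomial n (block_perm n (h(i := t)))) (y j))) =
          S"
        unfolding S_def
      proof (intro sum.cong refl arg_cong2[where f = "(*)"] arg_cong[where f = of_nat])
        fix j
        assume "j \<in> {..<k}"
        then have j: "j < k"
          by simp
        obtain p q where "x j = (p, q)"
          by fastforce
        then show "Poly_Mapping.lookup (perm_monomial n (block_perm n (h(i := t)))) (y j) =
            Poly_Mapping.lookup (perm_monomial n (block_perm n h)) (x j)"
          using row[OF i(3)[OF j], of t] j by (simp add: y_def lookup_perm_monomial)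
      qed
      ultimately show ?thesis
        by (simp only: L_def lessThan_Suc_atMost[symmetric] sum.lessThan_Suc of_nat_of_bool)
    qed
    have "S + Poly_Mapping.lookup (c k) \<mu> * of_bool t = 0" for t
    proof -
      have "\<forall>l\<in>D. (h(i := t)) l = h l"
        using i(2) by auto
      then show ?thesis
        using L0[of "h(i := t)"] L_upd[of t] by metis
    qed
    \<comment> \<open>The two values of the free bit give equations that differ exactly by the
      coefficient of \<open>\<mu>\<close> in \<open>c k\<close>.\<close>
    from this[of True] this[of False] have "Poly_Mapping.lookup (c k) \<mu> = 0"
      by simp
    \<comment> \<open>Deleting the added column restores the original minor, with sign
      \<open>(-1) ^ (k + k)\<close>, and \<open>\<mu>\<close> does occur there.\<close>
    moreover have "jacobian k b (y \<circ> insert_index k) = jacobian k b x"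
      by (intro eq_matI) (auto simp: jacobian_def insert_index_def y_def)
    ultimately show False
      using x by (simp add: c_def in_keys_iff power_add)
  qed
  then have "2 ^ (n div 2 - k) \<le> (2 :: nat) ^ card D"
    by (intro power_increasing) auto
  also have "\<dots> \<le> s ^ k"
    using D(2) cardT by (rule order_trans)
  finally show ?thesis
    using that k by blast
qed

text \<open>Replacing \<open>k\<close> by \<open>r\<close> in the block bound and taking
  \<open>r\<close>-th roots gives the claim, once \<open>n div 2 - r\<close> is bounded below by a
  multiple of \<open>n\<close>.\<close>

theorem theorem1p7:
  shows "\<exists>c>0. \<exists>K::real.
    \<forall>(n::nat) (m::nat) (r::nat) (s::nat) (\<chi> :: (nat \<Rightarrow> nat) \<Rightarrow> complex)
      (C :: 'a::field_char_0 circuit) (f :: nat \<Rightarrow> (nat \<times> nat, 'a) mpoly).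
      0 < r \<longrightarrow>
      is_nonzero_character n \<chi> \<longrightarrow>
      is_circuit m C \<longrightarrow>
      (\<forall>k\<in>{1..m}. indets (f k) \<subseteq> {1..n} \<times> {1..n} \<and> num_monomials (f k) \<le> s) \<longrightarrow>
      trdeg (f ` {1..m}) \<le> r \<longrightarrow>
      circuit_output C f = immanant n \<chi> \<longrightarrow>
      real n / real r \<ge> K \<longrightarrow>
      real s \<ge> 2 powr (c * (real n / real r))"
proof (rule exI[of _ "1 / 4"], intro conjI exI[of _ 6] allI impI)
  fix n m r s :: nat and \<chi> :: "(nat \<Rightarrow> nat) \<Rightarrow> complex" and C :: "'a circuit"
    and f :: "nat \<Rightarrow> (nat \<times> nat, 'a) mpoly"
  assume r: "0 < r" and \<chi>: "is_nonzero_character n \<chi>" and C: "is_circuit m C"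
    and s: "\<forall>k\<in>{1..m}. indets (f k) \<subseteq> {1..n} \<times> {1..n} \<and> num_monomials (f k) \<le> s"
    and trdeg: "trdeg (f ` {1..m}) \<le> r" and out: "circuit_output C f = immanant n \<chi>"
    and large: "6 \<le> real n / real r"
  obtain k where k: "k \<le> trdeg (f ` {1..m})" "2 ^ (n div 2 - k) \<le> s ^ k"
    using immanant_blocks_bound[OF \<chi> C _ out] s by blast
  have n: "6 * real r \<le> real n"
    using large r by (simp add: field_simps)
  then have "r < n div 2"
    using r by linarith
  have "k \<le> r"
    using k(1) trdeg by simp
  have "k > 0"
  proof (rule ccontr)
    assume "\<not> ?thesis"
    then have "(2 :: nat) ^ (n div 2) \<le> 1"
      using k(2) by simp
    then show False
      using \<open>r < n div 2\<close> one_less_power[of "2 :: nat" "n div 2"] by simp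
  qed
  \<comment> \<open>This allows the exponent of \<open>s\<close> to be raised from \<open>k\<close>
    to \<open>r\<close>.\<close>
  have "s > 0"
    using k(2) \<open>k > 0\<close> by (auto intro: Nat.gr0I simp: zero_power)
  have "(2 :: nat) ^ (n div 2 - r) \<le> 2 ^ (n div 2 - k)"
    using \<open>k \<le> r\<close> by (intro power_increasing) auto
  also have "\<dots> \<le> s ^ r"
    using k(2) power_increasing[OF \<open>k \<le> r\<close>, of s] \<open>s > 0\<close> by linarith
  finally have pow: "2 ^ (n div 2 - r) \<le> real s ^ r"
    by (metis of_nat_le_iff of_nat_numeral of_nat_power)
  \<comment> \<open>The constants come from here: \<open>r \<le> n / 6\<close> and
    \<open>n div 2 \<ge> (n - 1) / 2\<close> leave at least \<open>n / 3 - 1 / 2\<close>, which is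
    at least \<open>n / 4\<close> because \<open>n \<ge> 6\<close>.\<close>
  have "real n / 4 \<le> real (n div 2 - r)"
    using n r \<open>r < n div 2\<close> by linarith
  then have "2 powr (real n / 4) \<le> 2 powr real (n div 2 - r)"
    by simp
  also have "\<dots> \<le> real s powr real r"
    using pow \<open>s > 0\<close> by (simp add: powr_realpow)
  finally have "(2 powr (real n / 4)) powr (1 / real r) \<le> (real s powr real r) powr (1 / real r)"
    by (intro powr_mono2) auto
  then show "real s \<ge> 2 powr (1 / 4 * (real n / real r))"
    using r \<open>s > 0\<close> by (simp add: powr_powr)
qed simp

end
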